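(* For reduced words $\sigma,\tau$, we have $\widetilde P(\sigma)=\widetilde P(\tau)$ if and only if $\sigma$ and $\tau$ are Coxeter–Knuth equivalent.
   Context: Reduced words: a word $\rho=(\rho_\ell,\ldots,\rho_1)$ of positive integers ($\rho_\ell$ leftmost) is reduced if $s_{\rho_\ell}\cdots s_{\rho_1}$ is a permutation with exactly $\ell$ inversions ($s_i=(i\ i{+}1)$). Coxeter–Knuth equivalence. For $\rho=(\rho_m,\ldots,\rho_1)$: $\mathfrak c_j$ swaps $\rho_j,\rho_{j+1}$ if $|\rho_j-\rho_{j+1}|>1$, else identity; $\mathfrak b_j$ replaces $\rho_{j+1}\rho_j\rho_{j-1}$ by $\rho_j\rho_{j+1}\rho_j$ if $\rho_{j+1}=\rho_{j-1}$, else identity. $\mathfrak d_i(\rho)$ ($1<i<m$) is $\mathfrak b_i(\rho)$ if $\rho_{i+1}=\rho_{i-1}=\rho_i\pm1$; $\mathfrak c_{i-1}(\rho)$ if $\rho_{i-1}>\rho_{i+1}>\rho_i$ or $\rho_{i-1}<\rho_{i+1}<\rho_i$; $\mathfrak c_i(\rho)$ if $\rho_{i+1}>\rho_{i-1}>\rho_i$ or $\rho_{i+1}<\rho_{i-1}<\rho_i$; $\rho$ otherwise. Coxeter–Knuth equivalence is generated by the $\mathfrak d_i$. Runs, tableaux. The run decomposition writes $\rho=\rho^{(k)}\cdots\rho^{(1)}$ as maximal consecutive strictly increasing segments. An increasing Young tableau is a left-justified array of rows $R_1$ (bottom), $R_2,\dots$ with lengths weakly decreasing upward, rows strictly increasing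 left to right, columns strictly increasing upward; its row reading word is $\cdots R_2R_1$. Drop. Increasing words are written left to right, $\tau=\tau_1\cdots\tau_t$, $\sigma=\sigma_1\cdots\sigma_s$. Drop alignment of $\sigma$ below $\tau$: if $\tau_j>\sigma_j$ for all $j\le\min(s,t)$, $\sigma_j$ goes to column $j$; otherwise with $j_1$ least such that $\tau_{j_1}\le\sigma_{j_1}$, $\sigma_1..\sigma_{j_1-1}$ go to columns $1..j_1-1$, column $j_1$ gets nothing, and $\sigma_{j_1}\cdots\sigma_s$ is aligned recursively below $\tau_{j_1+1}\cdots\tau_t$. With $x_1,\dots,x_k$ the letters of $\tau$ with nothing below (left to right), $\tau=\tau^{(0)}x_1\tau^{(1)}\cdots x_k\tau^{(k)}$, $\sigma=\sigma^{(0)}\cdots\sigma^{(k)}\sigma^{(k+1)}$ ($\sigma^{(j)}$ directly below $\tau^{(j)}$, $\sigma^{(k+1)}$ right of column $t$). For $\tau\sigma$ reduced, $\mathrm{drop}(\tau\sigma)=(\tau^{(0)}\cdots\tau^{(k)},\ \sigma^{(0)}x_1\hat\sigma^{(1)}\cdots x_k\hat\sigma^{(k)}\sigma^{(k+1)})$ (top, bottom), $\hat\sigma^{(j)}_i=\sigma^{(j)}_i+1$ for $i\le b_j$, else unchanged, $b_j=\max\{b\ge0:\tau^{(j)}_i=\sigma^{(j)}_1+i\ \forall i\le b\}$ if $x_j=\tau^{(j)}_1-1$, else $0$. $\mathrm{drop}_i$ replaces rows $(R_{i+1},R_i)$ by $\mathrm{drop}(R_{i+1}R_i)$. For reduced $\pi$,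 $\mathrm{drop}(\pi)$: start from the run decomposition of $\pi$ as rows; while the nonempty rows do not form an increasing Young tableau, pick $k$ with $|R_{k+1}|>|R_k|$ or $R_{k+1,j}\le R_{k,j}$ for some $j\le\min(|R_k|,|R_{k+1}|)$ and apply $\mathrm{drop}_k$; the result is the increasing Young tableau $\mathrm{drop}(\pi)$. Lift. Lift alignment of $\tau$ above $\sigma$: if $\tau_{t-i+1}\ge\sigma_{s-i+1}$ for all $i\le\min(s,t)$, right justify; else with $i_1$ least such that $\tau_{t-i_1+1}<\sigma_{s-i_1+1}$, put $\tau_{t-i_1+2..t}$ above $\sigma_{s-i_1+2..s}$, nothing above $\sigma_{s-i_1+1}$, recurse on $\tau_1\cdots\tau_{t-i_1+1}$ above $\sigma_1\cdots\sigma_{s-i_1}$. With $x_1,\dots,x_k$ the letters of $\sigma$ with nothing above, $\sigma=\sigma^{(1)}x_1\sigma^{(2)}\cdots x_k\sigma^{(k+1)}$, $\tau=\tau^{(0)}\tau^{(1)}\cdots\tau^{(k+1)}$ ($\tau^{(j)}$ above $\sigma^{(j)}$, $\tau^{(0)}$ left of $\sigma$); $\mathrm{lift}(\tau\sigma)=(\tau^{(0)}\tau^{(1)}x_1\tau^{(2)}\cdots x_k\tau^{(k+1)},\ \sigma^{(1)}\check\sigma^{(2)}\cdots\check\sigma^{(k+1)})$, $\check\sigma^{(j+1)}_i=\sigma^{(j+1)}_i-1$ for $i\le b_j$, else unchanged, $b_j=\max\{b:\tau^{(j+1)}_i=\sigma^{(j+1)}_i=x_j+i\ \forall i\le b\}$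 if $x_j=\sigma^{(j+1)}_1-1$, else $0$. $\mathrm{lift}_i$ replaces $(R_{i+1},R_i)$ by $\mathrm{lift}(R_{i+1}R_i)$; it acts faithfully on $T$ if it changes $T$; $\mathrm{lift}_{[i,j]}=\mathrm{lift}_j\circ\cdots\circ\mathrm{lift}_i$ acts faithfully if $\mathrm{lift}_i$ does on $T$ and each $\mathrm{lift}_k$ does on $\mathrm{lift}_{[i,k-1]}(T)$. For $P$ an increasing Young tableau with reduced reading word: $T_0=P$; if every $\mathrm{lift}_i$ fixes $T_{k-1}$, $\mathrm{lift}(P)=T_{k-1}$; else $T_k=\mathrm{lift}_{[i_k,j_k]}(T_{k-1})$ with $j_k$ the largest $j$ admitting some $i\le j$ with $\mathrm{lift}_{[i,j]}$ faithful on $T_{k-1}$ and $i_k$ the least such $i$ for $j=j_k$. Insertion. Edelman–Greene insertion $P\leftarrow x$ of a positive integer $x$ into an increasing Young tableau $P$ (rows $P_1$ bottom, $P_2,\dots$): $x_0=x$; for $i\ge0$, if $x_i\ge z$ for all $z\in P_{i+1}$ (possibly empty), append $x_i$ to $P_{i+1}$ and stop; else let $x_{i+1}$ be the smallest entry of $P_{i+1}$ greater than $x_i$, replace $x_{i+1}$ by $x_i$ in $P_{i+1}$ unless $x_{i+1}=x_i+1$ and $x_i\in P_{i+1}$ (then the row is unchanged), and insert $x_{i+1}$ into $P_{i+2}$. For $\rho=(\rho_k,\ldots,\rho_1)$, let $\pi_{k+1}$ be the empty word and, for $i=k,\ldots,1$, $\pi_i$ the row reading word of $\mathrm{lift}(\mathrm{drop}(\pi_{i+1})\leftarrow\rho_i)$;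 the weak insertion tableau is $\widetilde P(\rho)=\pi_1$ (equivalently, the key tableau obtained by placing the run decomposition of $\pi_1$ in the rows indicated by its weak descent composition). *)

theory Defs
  imports
    Main
    "HOL-Combinatorics.Transposition"
    "HOL-Library.While_Combinator"
begin

(* Words are lists written left to right: the word (rho_l, ..., rho_1) is [rho_l, ..., rho_1],
   so rho_i is the list entry at position l - i. *)

definition word_perm :: "nat list \<Rightarrow> nat \<Rightarrow> nat" where
  "word_perm w = foldr (\<lambda>i p. transpose i (Suc i) \<circ> p) w id"

definition inversions :: "(nat \<Rightarrow> nat) \<Rightarrow> (nat \<times> nat) set" where
  "inversions p = {(i, j). i < j \<and> p j < p i}"

definition reduced :: "nat list \<Rightarrow> bool" where
  "reduced w \<longleftrightarrow> (\<forall>i\<in>set w. 0 < i) \<and> card (inversions (word_perm w)) = length w"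


section \<open>Coxeter--Knuth equivalence\<close>

definition letter :: "nat list \<Rightarrow> nat \<Rightarrow> nat" where
  "letter w i = w ! (length w - i)"

definition set_letter :: "nat \<Rightarrow> nat \<Rightarrow> nat list \<Rightarrow> nat list" where
  "set_letter i x w = w[length w - i := x]"

definition ck_c :: "nat \<Rightarrow> nat list \<Rightarrow> nat list" where
  "ck_c j w =
    (if \<bar>int (letter w j) - int (letter w (j + 1))\<bar> > 1
     then set_letter j (letter w (j + 1)) (set_letter (j + 1) (letter w j) w) else w)"

definition ck_b :: "nat \<Rightarrow> nat list \<Rightarrow> nat list" where
  "ck_b j w =
    (if letter w (j + 1) = letter w (j - 1)
     then set_letter (j + 1) (letter w j)
            (set_letter j (letter w (j + 1)) (set_letter (j - 1) (letter w j) w))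
     else w)"

definition ck_d :: "nat \<Rightarrow> nat list \<Rightarrow> nat list" where
  "ck_d i w =
    (let l = letter w (i + 1); m = letter w i; r = letter w (i - 1) in
     if l = r \<and> (r = m + 1 \<or> r + 1 = m) then ck_b i w
     else if (r > l \<and> l > m) \<or> (r < l \<and> l < m) then ck_c (i - 1) w
     else if (l > r \<and> r > m) \<or> (l < r \<and> r < m) then ck_c i w
     else w)"

definition coxeter_knuth_equiv :: "nat list \<Rightarrow> nat list \<Rightarrow> bool" where
  "coxeter_knuth_equiv = equivclp (\<lambda>v w. \<exists>i. 1 < i \<and> i < length v \<and> w = ck_d i v)"


section \<open>Runs and tableaux\<close>

(* An array of rows is the list of its rows from bottom to top: R ! k is the row R_(k+1). *)

fun runs :: "nat list \<Rightarrow> nat list list" where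
  "runs [] = []"
| "runs [x] = [[x]]"
| "runs (x # y # w) =
    (if x < y then (x # hd (runs (y # w))) # tl (runs (y # w)) else [x] # runs (y # w))"

definition run_rows :: "nat list \<Rightarrow> nat list list" where
  "run_rows w = rev (runs w)"

definition row_reading_word :: "nat list list \<Rightarrow> nat list" where
  "row_reading_word R = concat (rev R)"

definition increasing_young_tableau :: "nat list list \<Rightarrow> bool" where
  "increasing_young_tableau R \<longleftrightarrow>
    (\<forall>r\<in>set R. r \<noteq> [] \<and> sorted_wrt (<) r) \<and>
    (\<forall>k. Suc k < length R \<longrightarrow>
       length (R ! Suc k) \<le> length (R ! k) \<and>
       (\<forall>j < length (R ! Suc k). R ! k ! j < R ! Suc k ! j))"


section \<open>Alignment\<close>

(* Letter-by-letter form of the alignments: the letters of the first word are visited in order,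
   and each is given the next unused letter of the second word if the two satisfy P, and nothing
   otherwise.  Restarting after the first failing column with the same pending letter of the
   second word is exactly the recursion in the definition of the drop and lift alignments.
   The second component of the result consists of the letters left over. *)
fun align :: "(nat \<Rightarrow> nat \<Rightarrow> bool) \<Rightarrow> nat list \<Rightarrow> nat list \<Rightarrow> (nat \<times> nat option) list \<times> nat list"
  where
  "align P [] ys = ([], ys)"
| "align P (x # xs) [] = ((x, None) # fst (align P xs []), [])"
| "align P (x # xs) (y # ys) =
    (if P x y then map_prod (Cons (x, Some y)) id (align P xs ys)
     else map_prod (Cons (x, None)) id (align P xs (y # ys)))"

(* Cuts an alignment, read left to right, at its unmatched letters x_1, ..., x_k: the first
   component is the initial matched pair of words, the second lists each x_j with the matched
   pair of words that follows it. *)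
fun blocks :: "(nat \<times> nat option) list \<Rightarrow>
    (nat list \<times> nat list) \<times> (nat \<times> nat list \<times> nat list) list" where
  "blocks [] = (([], []), [])"
| "blocks ((x, Some y) # al) =
    (case blocks al of ((u, v), bs) \<Rightarrow> ((x # u, y # v), bs))"
| "blocks ((x, None) # al) =
    (case blocks al of ((u, v), bs) \<Rightarrow> (([], []), (x, u, v) # bs))"


section \<open>Drop\<close>

(* In drop_bound, drop_hat, lift_bound and lift_check, the arguments t and s are the corresponding blocks
   of tau and sigma, both of the same length, and x is the letter preceding them. *)

definition drop_bound :: "nat \<Rightarrow> nat list \<Rightarrow> nat list \<Rightarrow> nat" where
  "drop_bound x t s =
    (if t \<noteq> [] \<and> x + 1 = t ! 0
     then Max {b \<in> {..length t}. (\<forall>i\<in>{1..b}. t ! (i - 1) = s ! 0 + i)} else 0)"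

definition drop_hat :: "nat \<Rightarrow> nat list \<Rightarrow> nat list \<Rightarrow> nat list" where
  "drop_hat x t s = (let b = drop_bound x t s in map Suc (take b s) @ drop b s)"

definition drop_pair :: "nat list \<Rightarrow> nat list \<Rightarrow> nat list \<times> nat list" where
  "drop_pair \<tau> \<sigma> =
    (case align (>) \<tau> \<sigma> of (al, rest) \<Rightarrow>
     case blocks al of ((t0, s0), bs) \<Rightarrow>
       (t0 @ concat (map (\<lambda>(x, t, s). t) bs),
        s0 @ concat (map (\<lambda>(x, t, s). x # drop_hat x t s) bs) @ rest))"

definition drop_at :: "nat \<Rightarrow> nat list list \<Rightarrow> nat list list" where
  "drop_at k R =
    (case drop_pair (R ! Suc k) (R ! k) of (\<tau>, \<sigma>) \<Rightarrow> R[k := \<sigma>, Suc k := \<tau>])"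

abbreviation nonempty_rows :: "nat list list \<Rightarrow> nat list list" where
  "nonempty_rows R \<equiv> filter (\<lambda>r. r \<noteq> []) R"

definition drop_step :: "nat list list \<Rightarrow> nat list list \<Rightarrow> bool" where
  "drop_step R R' \<longleftrightarrow>
    \<not> increasing_young_tableau (nonempty_rows R) \<and>
    (\<exists>k. Suc k < length R \<and>
       (length (R ! Suc k) > length (R ! k) \<or>
        (\<exists>j < min (length (R ! k)) (length (R ! Suc k)). R ! Suc k ! j \<le> R ! k ! j)) \<and>
       R' = drop_at k R)"

(* The row to which a drop is applied is an arbitrary choice at every step; the definite
   description expresses that the tableau reached does not depend on these choices. *)
definition drop_word :: "nat list \<Rightarrow> nat list list" where
  "drop_word w =
    (THE T. \<exists>R. drop_step\<^sup>*\<^sup>* (run_rows w) R \<and> T = nonempty_rows R \<and>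
       increasing_young_tableau T)"


section \<open>Lift\<close>

definition lift_bound :: "nat \<Rightarrow> nat list \<Rightarrow> nat list \<Rightarrow> nat" where
  "lift_bound x s t =
    (if s \<noteq> [] \<and> x + 1 = s ! 0
     then Max {b \<in> {..length s}. (\<forall>i\<in>{1..b}. t ! (i - 1) = x + i \<and> s ! (i - 1) = x + i)}
     else 0)"

definition lift_check :: "nat \<Rightarrow> nat list \<Rightarrow> nat list \<Rightarrow> nat list" where
  "lift_check x s t = (let b = lift_bound x s t in map (\<lambda>a. a - 1) (take b s) @ drop b s)"

(* The lift alignment runs from right to left, hence the reversals. *)
definition lift_pair :: "nat list \<Rightarrow> nat list \<Rightarrow> nat list \<times> nat list" where
  "lift_pair \<tau> \<sigma> =
    (case align (\<le>) (rev \<sigma>) (rev \<tau>) of (al, rest) \<Rightarrow>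
     case blocks (rev al) of ((s1, t1), bs) \<Rightarrow>
       (rev rest @ t1 @ concat (map (\<lambda>(x, s, t). x # t) bs),
        s1 @ concat (map (\<lambda>(x, s, t). lift_check x s t) bs)))"

definition lift_at :: "nat \<Rightarrow> nat list list \<Rightarrow> nat list list" where
  "lift_at k R =
    (case lift_pair (R ! Suc k) (R ! k) of (\<tau>, \<sigma>) \<Rightarrow> R[k := \<sigma>, Suc k := \<tau>])"

(* lift_at i, ..., lift_at (j - 1) applied in this order: the right end is exclusive. *)
definition lift_seq :: "nat \<Rightarrow> nat \<Rightarrow> nat list list \<Rightarrow> nat list list" where
  "lift_seq i j R = fold lift_at [i..<j] R"

(* lift_(i+1) moves letters between two existing rows: no empty row is ever added on top. *)
definition lift_faithful :: "nat \<Rightarrow> nat \<Rightarrow> nat list list \<Rightarrow> bool" where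
  "lift_faithful i j R \<longleftrightarrow>
    i \<le> j \<and> Suc j < length R \<and>
    (\<forall>k\<in>{i..j}. lift_at k (lift_seq i k R) \<noteq> lift_seq i k R)"

definition lift_step :: "nat list list \<Rightarrow> nat list list" where
  "lift_step R =
    (let j = (GREATEST j. \<exists>i. lift_faithful i j R);
         i = (LEAST i. lift_faithful i j R)
     in lift_seq i (Suc j) R)"

definition lift_tableau :: "nat list list \<Rightarrow> nat list list" where
  "lift_tableau P = while (\<lambda>R. \<exists>i. Suc i < length R \<and> lift_at i R \<noteq> R) lift_step P"


section \<open>Weak insertion\<close>

fun eg_insert :: "nat list list \<Rightarrow> nat \<Rightarrow> nat list list" where
  "eg_insert [] x = [[x]]"
| "eg_insert (r # P) x =
    (if \<forall>z\<in>set r. x \<ge> z then (r @ [x]) # P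
     else let y = Min {z \<in> set r. z > x} in
       (if y = x + 1 \<and> x \<in> set r then r else map (\<lambda>z. if z = y then x else z) r) #
       eg_insert P y)"

(* The weak insertion tableau, recorded by its row reading word. *)
definition weak_insertion_tableau :: "nat list \<Rightarrow> nat list" where
  "weak_insertion_tableau w =
    foldl (\<lambda>\<pi> x. row_reading_word (lift_tableau (eg_insert (drop_word \<pi>) x))) [] w"

end

theory Submission
  imports Defs
begin

text \<open>
  All tableaux in the definition of the weak insertion tableau are controlled by the
  Edelman--Greene tableau.  Reducedness enters only through the fact that no word in the
  braid class of a reduced word contains a square; this excludes the degenerate cases of row
  insertion.  Inserting a letter into a row is a Coxeter--Knuth equivalence, and
  Coxeter--Knuth equivalent triples inserted into a row leave the same row and bump
  equal or Coxeter--Knuth equivalent words, so the Edelman--Greene tableau is a complete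
  invariant of the class and is the only increasing tableau whose reading word lies in it.

  The drop of two rows is row insertion of the lower row into the upper one, and the lift is
  the mirror image of this, so both preserve the class; drops lower the letters and lifts
  raise them, so both procedures terminate.  Hence dropping a word yields its
  Edelman--Greene tableau, the weak insertion tableau is the lift of the Edelman--Greene
  tableau, and it lies in the class of the word.
\<close>

section \<open>Braid classes and Coxeter--Knuth classes\<close>

text \<open>\<open>square_free_class\<close> replaces reducedness because it passes to factors and
  along \<simeq>, so every intermediate array inherits it. It acts by sliding: a letter that
  commutes with everything up to its next copy would meet that copy and form a square, so a letter
  differing from it by one must lie in between. That neighbour is exactly what special bumping
  needs. Column strictness of the Edelman--Greene tableau is obtained indirectly: inserting the
  reading word of an increasing tableau gives the tableau back, and dropping ends in some increasing
  tableau of the same class, so the two agree. The lift is harder than the drop. Its intermediate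
  row consists of the untreated lower letters followed by the finished part of the new top; upper
  letters enter it from the left and eject letters to the right, which form the new lower row. A
  column \<open>a\<close> over \<open>a\<close> cannot be processed when it is met, since the move
  needs \<open>a - 1\<close>, a lower letter not yet reached; this is what forces the postponed
  state in \<open>lift_state\<close>.\<close>

inductive braid_step :: "nat list \<Rightarrow> nat list \<Rightarrow> bool" where
  commute: "Suc x < y \<Longrightarrow> braid_step (p @ [x, y] @ q) (p @ [y, x] @ q)"
| braid: "braid_step (p @ [x, Suc x, x] @ q) (p @ [Suc x, x, Suc x] @ q)"

text \<open>The windows on which some \<open>ck_d\<close> acts nontrivially, one orientation of each
  pair. The letter strictly between the two swapped ones makes them differ by at least 2, so the
  commutation condition of \<open>ck_c\<close> holds by itself.\<close>

inductive ck_triple :: "nat list \<Rightarrow> nat list \<Rightarrow> bool" where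
  bac_bca: "a < b \<Longrightarrow> b < c \<Longrightarrow> ck_triple [b, a, c] [b, c, a]"
| acb_cab: "a < b \<Longrightarrow> b < c \<Longrightarrow> ck_triple [a, c, b] [c, a, b]"
| braid: "ck_triple [x, Suc x, x] [Suc x, x, Suc x]"

inductive ck_step :: "nat list \<Rightarrow> nat list \<Rightarrow> bool" where
  "ck_triple u v \<Longrightarrow> ck_step (p @ u @ q) (p @ v @ q)"

abbreviation braid_equiv :: "nat list \<Rightarrow> nat list \<Rightarrow> bool" where
  "braid_equiv \<equiv> equivclp braid_step"

abbreviation ck_equiv :: "nat list \<Rightarrow> nat list \<Rightarrow> bool"  (infix \<open>\<simeq>\<close> 50) where
  "u \<simeq> v \<equiv> equivclp ck_step u v"

text \<open>By Tits' solution of the word problem this is reducedness up to positivity of the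
  letters; only the implication from \<open>reduced\<close> is proved here.\<close>

definition square_free_class :: "nat list \<Rightarrow> bool" where
  "square_free_class w \<longleftrightarrow> (\<forall>p x q. \<not> braid_equiv w (p @ [x, x] @ q))"

lemma equivclp_cong:
  assumes "equivclp r x y" and "\<And>x y. r x y \<Longrightarrow> r (f x) (f y)"
  shows "equivclp r (f x) (f y)"
  using assms(1)
proof (induction rule: equivclp_induct)
  case (step y z)
  then show ?case
    using assms(2) by (blast intro: equivclp_trans r_into_equivclp equivclp_sym)
qed simp

lemma equivclp_mono_step:
  assumes "equivclp r x y" and "\<And>x y. r x y \<Longrightarrow> equivclp s x y"
  shows "equivclp s x y"
  using assms(1)
proof (induction rule: equivclp_induct)
  case (step y z)
  then show ?case
    using assms(2) by (blast intro: equivclp_trans equivclp_sym)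
qed simp

lemma braid_step_context: "braid_step u v \<Longrightarrow> braid_step (p @ u @ q) (p @ v @ q)"
proof (induction rule: braid_step.induct)
  case (commute x y p' q')
  from braid_step.commute[OF this, of "p @ p'" "q' @ q"] show ?case by simp
next
  case (braid p' x q')
  from braid_step.braid[of "p @ p'" x "q' @ q"] show ?case by simp
qed

lemma braid_equiv_context: "braid_equiv u v \<Longrightarrow> braid_equiv (p @ u @ q) (p @ v @ q)"
  by (rule equivclp_cong[of _ _ _ "\<lambda>w. p @ w @ q"]) (auto intro: braid_step_context)

lemma ck_step_context: "ck_step u v \<Longrightarrow> ck_step (p @ u @ q) (p @ v @ q)"
proof (induction rule: ck_step.induct)
  case (1 u v p' q')
  from ck_step.intros[OF this, of "p @ p'" "q' @ q"] show ?case by simp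
qed

lemma ck_equiv_context: "u \<simeq> v \<Longrightarrow> p @ u @ q \<simeq> p @ v @ q"
  by (rule equivclp_cong[of _ _ _ "\<lambda>w. p @ w @ q"]) (auto intro: ck_step_context)

lemma ck_equiv_append: "u \<simeq> u' \<Longrightarrow> v \<simeq> v' \<Longrightarrow> u @ v \<simeq> u' @ v'"
  using ck_equiv_context[of u u' "[]" v] ck_equiv_context[of v v' u' "[]"]
  by (auto intro: equivclp_trans)

lemma ck_equiv_Cons: "u \<simeq> v \<Longrightarrow> x # u \<simeq> x # v"
  using ck_equiv_context[of u v "[x]" "[]"] by simp

lemma ck_triple_equiv: "ck_triple u v \<Longrightarrow> p @ u @ q \<simeq> p @ v @ q"
  by (auto intro: r_into_equivclp ck_step.intros)

lemma ck_triple_braid_step: "ck_triple u v \<Longrightarrow> braid_step u v \<or> braid_step v u"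
proof (induction rule: ck_triple.induct)
  case (bac_bca a b c)
  then show ?case using braid_step.commute[of a c "[b]" "[]"] by simp
next
  case (acb_cab a b c)
  then show ?case using braid_step.commute[of a c "[]" "[b]"] by simp
next
  case (braid x)
  then show ?case using braid_step.braid[of "[]" x "[]"] by simp
qed

lemma ck_step_braid_equiv: "ck_step u v \<Longrightarrow> braid_equiv u v"
  by (induction rule: ck_step.induct)
    (metis ck_triple_braid_step braid_equiv_context r_into_equivclp equivclp_sym)

lemma ck_equiv_braid_equiv: "u \<simeq> v \<Longrightarrow> braid_equiv u v"
  by (erule equivclp_mono_step) (rule ck_step_braid_equiv)

lemma square_free_class_ck:
  "u \<simeq> v \<Longrightarrow> square_free_class u \<Longrightarrow> square_free_class v"
  unfolding square_free_class_def by (blast dest: ck_equiv_braid_equiv intro: equivclp_trans)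

lemma square_free_class_factor: "square_free_class (p @ u @ q) \<Longrightarrow> square_free_class u"
  unfolding square_free_class_def by (metis append.assoc braid_equiv_context)

lemma square_free_class_prefix: "square_free_class (u @ q) \<Longrightarrow> square_free_class u"
  using square_free_class_factor[of "[]" u q] by simp

lemma square_free_class_suffix: "square_free_class (p @ u) \<Longrightarrow> square_free_class u"
  using square_free_class_factor[of p u "[]"] by simp

lemma square_free_class_no_square: "\<not> square_free_class (p @ [x, x] @ q)"
  unfolding square_free_class_def by (metis equivclp_refl)

lemma braid_equiv_commute_right:
  assumes "\<forall>y\<in>set u. Suc x < y \<or> Suc y < x"
  shows "braid_equiv (x # u) (u @ [x])"
  using assms
proof (induction u)
  case (Cons y u)
  have swap: "braid_equiv ([x, y] @ u) ([y, x] @ u)"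
    using Cons.prems braid_step.commute[of x y "[]" u] braid_step.commute[of y x "[]" u]
    by (auto intro: r_into_equivclp equivclp_sym)
  have "braid_equiv ([y] @ (x # u) @ []) ([y] @ (u @ [x]) @ [])"
    using Cons by (intro braid_equiv_context) auto
  then have "braid_equiv ([y, x] @ u) (y # u @ [x])" by simp
  with swap show ?case by (auto intro: equivclp_trans)
qed simp

text \<open>The first \<open>x\<close> slides through \<open>u\<close> until it touches the second.
  Both \<open>Suc_mem_row\<close> and \<open>last_pred_row\<close> rest on this.\<close>

lemma not_square_free_commuting:
  assumes "\<forall>y\<in>set u. Suc x < y \<or> Suc y < x"
  shows "\<not> square_free_class (p @ [x] @ u @ [x] @ q)"
proof
  assume "square_free_class (p @ [x] @ u @ [x] @ q)"
  moreover have "braid_equiv (p @ (x # u) @ ([x] @ q)) (p @ (u @ [x]) @ ([x] @ q))"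
    using assms by (intro braid_equiv_context braid_equiv_commute_right)
  then have "braid_equiv (p @ [x] @ u @ [x] @ q) ((p @ u) @ [x, x] @ q)" by simp
  ultimately show False unfolding square_free_class_def by blast
qed

section \<open>Reduced words have square-free braid classes\<close>

lemma word_perm_append: "word_perm (u @ v) = word_perm u \<circ> word_perm v"
  by (induction u) (auto simp: word_perm_def o_assoc)

lemma inj_word_perm: "inj (word_perm w)"
proof (induction w)
  case (Cons i w)
  then have "inj (transpose i (Suc i) \<circ> word_perm w)" by (intro inj_compose) auto
  then show ?case by (simp add: word_perm_def comp_def)
qed (simp add: word_perm_def)

lemma braid_step_word_perm: "braid_step u v \<Longrightarrow> word_perm u = word_perm v \<and> length u = length v"
proof (induction rule: braid_step.induct)
  case (commute x y p q)
  then have "word_perm [x, y] = word_perm [y, x]"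
    by (auto simp: word_perm_def transpose_def fun_eq_iff)
  then show ?case by (simp only: word_perm_append) simp
next
  case (braid p x q)
  have "word_perm [x, Suc x, x] = word_perm [Suc x, x, Suc x]"
    by (auto simp: word_perm_def transpose_def fun_eq_iff)
  then show ?case by (simp only: word_perm_append) simp
qed

lemma braid_equiv_word_perm: "braid_equiv u v \<Longrightarrow> word_perm u = word_perm v \<and> length u = length v"
  by (induction rule: equivclp_induct) (auto dest: braid_step_word_perm)

text \<open>Exchanging the values i and i + 1 preserves the order of all other pairs of values, so
  only the pair of positions carrying these two can become inverted. If a value is not attained,
  \<open>inv f\<close> is arbitrary there, which does no harm to an upper bound.\<close>

lemma inversions_transpose_comp:
  assumes "inj f"
  shows "inversions (transpose i (Suc i) \<circ> f) \<subseteq> insert (inv f i, inv f (Suc i)) (inversions f)"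
proof
  fix z assume "z \<in> inversions (transpose i (Suc i) \<circ> f)"
  then obtain a b where z: "z = (a, b)" "a < b"
    and less: "transpose i (Suc i) (f b) < transpose i (Suc i) (f a)"
    by (auto simp: inversions_def)
  show "z \<in> insert (inv f i, inv f (Suc i)) (inversions f)"
  proof (cases "f b < f a")
    case True
    then show ?thesis using z by (simp add: inversions_def)
  next
    case False
    then have "f a < f b" using z assms by (metis inj_eq linorder_neqE_nat less_irrefl)
    then have "f a = i \<and> f b = Suc i"
      using less by (auto simp: transpose_def split: if_splits)
    then show ?thesis using z assms by (metis inv_f_f insertI1)
  qed
qed

lemma card_inversions_word_perm:
  "finite (inversions (word_perm w)) \<and> card (inversions (word_perm w)) \<le> length w"
proof (induction w)
  case Nil
  have "inversions (word_perm []) = {}" by (auto simp: inversions_def word_perm_def)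
  then show ?case by simp
next
  case (Cons i w)
  have "word_perm (i # w) = transpose i (Suc i) \<circ> word_perm w" by (simp add: word_perm_def)
  then have sub: "inversions (word_perm (i # w))
      \<subseteq> insert (inv (word_perm w) i, inv (word_perm w) (Suc i)) (inversions (word_perm w))"
    using inversions_transpose_comp[OF inj_word_perm] by metis
  have "card (insert (inv (word_perm w) i, inv (word_perm w) (Suc i)) (inversions (word_perm w)))
      \<le> Suc (length w)"
    using Cons card_insert_le_m1 by (simp add: card_insert_if)
  with sub Cons show ?case
    by (metis card_mono finite.insertI finite_subset le_trans length_Cons)
qed

text \<open>Deleting a square keeps the permutation and shortens the word by two, but a word has at
  least as many letters as its permutation has inversions.\<close>

lemma reduced_square_free_class:
  assumes "reduced w"
  shows "square_free_class w"
  unfolding square_free_class_def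
proof (intro allI notI)
  fix p x q assume "braid_equiv w (p @ [x, x] @ q)"
  then have eq: "word_perm w = word_perm (p @ [x, x] @ q)" "length w = length (p @ [x, x] @ q)"
    using braid_equiv_word_perm by blast+
  have "word_perm [x, x] = id" by (auto simp: word_perm_def)
  then have "word_perm w = word_perm (p @ q)" unfolding eq by (simp only: word_perm_append) simp
  then have "card (inversions (word_perm w)) \<le> length (p @ q)"
    using card_inversions_word_perm by metis
  then show False using assms eq(2) by (simp add: reduced_def)
qed

section \<open>The operators \<open>ck_d\<close> in terms of three-letter windows\<close>

lemma letter_append:
  "letter (p @ [l, m, r] @ q) (length q + 3) = l"
  "letter (p @ [l, m, r] @ q) (length q + 2) = m"
  "letter (p @ [l, m, r] @ q) (length q + 1) = r"
  by (simp_all add: letter_def nth_append)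

lemma set_letter_append:
  "set_letter (length q + 3) x (p @ [l, m, r] @ q) = p @ [x, m, r] @ q"
  "set_letter (length q + 2) x (p @ [l, m, r] @ q) = p @ [l, x, r] @ q"
  "set_letter (length q + 1) x (p @ [l, m, r] @ q) = p @ [l, m, x] @ q"
  by (simp_all add: set_letter_def list_update_append)

text \<open>Letters are numbered from the right, so in front of a suffix \<open>q\<close> the window
  has the indices \<open>length q + 1\<close> to \<open>length q + 3\<close>, and
  \<open>ck_d\<close> is named after the middle one.\<close>

lemma ck_d_append:
  "ck_d (length q + 2) (p @ [l, m, r] @ q) =
    p @ (if l = r \<and> (r = m + 1 \<or> r + 1 = m) then [m, l, m]
         else if (r > l \<and> l > m) \<or> (r < l \<and> l < m) then [l, r, m]
         else if (l > r \<and> r > m) \<or> (l < r \<and> r < m) then [m, l, r]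
         else [l, m, r]) @ q"
proof -
  let ?w = "p @ [l, m, r] @ q"
  have ix: "length q + 2 + 1 = length q + 3" "length q + 2 - 1 = length q + 1"
    "length q + 1 + 1 = length q + 2" by simp_all
  have b: "ck_b (length q + 2) ?w = p @ [m, l, m] @ q" if "l = r"
    unfolding ck_b_def ix letter_append set_letter_append using that by simp
  have c1: "ck_c (length q + 1) ?w = p @ [l, r, m] @ q" if "m + 1 < r \<or> r + 1 < m"
    unfolding ck_c_def ix letter_append set_letter_append using that by auto
  have c2: "ck_c (length q + 2) ?w = p @ [m, l, r] @ q" if "m + 1 < l \<or> l + 1 < m"
    unfolding ck_c_def ix letter_append set_letter_append using that by auto
  show ?thesis
    unfolding ck_d_def Let_def ix letter_append using b c1 c2 by auto
qed

lemma ck_d_equiv: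
  assumes "1 < i" "i < length w"
  shows "w \<simeq> ck_d i w"
proof -
  define p where "p = take (length w - (i + 1)) w"
  define q where "q = drop (length w - (i - 2)) w"
  have "length (drop (length w - (i + 1)) (take (length w - (i - 2)) w)) = 3"
    using assms by simp
  then obtain l m r where lmr: "drop (length w - (i + 1)) (take (length w - (i - 2)) w) = [l, m, r]"
    unfolding numeral_3_eq_3 length_Suc_conv length_0_conv by blast
  have "take (length w - (i - 2)) w = p @ [l, m, r]"
    using append_take_drop_id[of "length w - (i + 1)" "take (length w - (i - 2)) w"] assms
    unfolding lmr p_def by (simp add: min_def split: if_splits)
  then have w: "w = p @ [l, m, r] @ q"
    using append_take_drop_id[of "length w - (i - 2)" w] unfolding q_def by simp
  have i: "i = length q + 2" using assms by (simp add: q_def)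
  show ?thesis
    unfolding i w ck_d_append
    using ck_triple_equiv[OF ck_triple.bac_bca, of m l r p q]
      ck_triple_equiv[OF ck_triple.bac_bca, of r l m p q, THEN equivclp_sym]
      ck_triple_equiv[OF ck_triple.acb_cab, of l r m p q]
      ck_triple_equiv[OF ck_triple.acb_cab, of m r l p q, THEN equivclp_sym]
      ck_triple_equiv[OF ck_triple.braid, of p l q]
      ck_triple_equiv[OF ck_triple.braid, of p m q, THEN equivclp_sym]
    by auto
qed

lemma ck_step_ck_d:
  assumes "ck_step u v"
  shows "\<exists>i. 1 < i \<and> i < length u \<and> v = ck_d i u"
  using assms
proof (cases rule: ck_step.cases)
  case (1 u' v' p q)
  from 1(3) obtain l m r where u': "u' = [l, m, r]" by (cases rule: ck_triple.cases) auto
  have "ck_d (length q + 2) (p @ [l, m, r] @ q) = p @ v' @ q"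
    unfolding ck_d_append using 1(3) unfolding u' by (cases rule: ck_triple.cases) auto
  then show ?thesis unfolding 1 u' by (intro exI[of _ "length q + 2"]) auto
qed

lemma coxeter_knuth_equiv_iff: "coxeter_knuth_equiv u v \<longleftrightarrow> u \<simeq> v"
proof
  assume "coxeter_knuth_equiv u v"
  then show "u \<simeq> v"
    unfolding coxeter_knuth_equiv_def by (rule equivclp_mono_step) (auto intro: ck_d_equiv)
next
  assume "u \<simeq> v"
  then show "coxeter_knuth_equiv u v"
    unfolding coxeter_knuth_equiv_def
    by (rule equivclp_mono_step) (blast intro: r_into_equivclp dest: ck_step_ck_d)
qed

section \<open>Inserting one letter into a row\<close>

text \<open>\<open>s\<close> hops over \<open>C\<close> one letter at a time. The letter just left
  of it is the witness: \<open>y s c\<close> becomes \<open>y c s\<close> as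
  \<open>s < y < c\<close>, and then \<open>c\<close> is the witness for the next hop.\<close>

lemma ck_equiv_move_right:
  assumes "sorted_wrt (<) (y # C)" "s < y"
  shows "y # s # C \<simeq> y # C @ [s]"
  using assms
proof (induction C arbitrary: y)
  case (Cons c C)
  then have "y # s # c # C \<simeq> y # c # s # C"
    using ck_triple_equiv[OF ck_triple.bac_bca, of s y c "[]" C] by simp
  also have "\<dots> \<simeq> y # c # C @ [s]"
    using Cons.IH[of c] Cons.prems by (auto intro: ck_equiv_Cons[where x = y])
  finally show ?case by simp
qed simp

text \<open>Here the witness stands on the right: \<open>y a b\<close> becomes \<open>a y b\<close>
  as \<open>a < b < y\<close>. The letter \<open>x\<close> serves only as the last witness, so
  \<open>y\<close> stops in front of it.\<close>

lemma ck_equiv_move_left: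
  assumes "sorted_wrt (<) (u @ [x])" "x < y"
  shows "y # u @ [x] \<simeq> u @ [y, x]"
  using assms
proof (induction u)
  case (Cons a u)
  obtain b r where br: "u @ [x] = b # r" by (cases "u @ [x]") auto
  then have "b \<in> set (u @ [x])" by simp
  with Cons.prems have "a < b" "b \<le> x" by (auto simp: sorted_wrt_append le_less)
  then have "b < y" using Cons.prems by simp
  then have "y # a # u @ [x] \<simeq> a # y # u @ [x]"
    using \<open>a < b\<close> ck_triple_equiv[OF ck_triple.acb_cab, of a b y "[]" r] br
    by (auto intro: equivclp_sym)
  also have "\<dots> \<simeq> a # u @ [y, x]"
    using Cons by (intro ck_equiv_Cons) simp
  finally show ?case by simp
qed simp

text \<open>\<open>x\<close> travels left through \<open>A\<close> until it is next to
  \<open>y\<close>; then \<open>y\<close> travels left through \<open>B\<close>, with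
  \<open>x\<close> as the last witness.\<close>

lemma ck_equiv_bump:
  assumes "sorted_wrt (<) (B @ y # A)" "\<forall>b\<in>set B. b < x" "x < y"
  shows "(B @ y # A) @ [x] \<simeq> y # B @ x # A"
proof -
  have "B @ (y # x # A) \<simeq> B @ (y # A @ [x])"
    using assms by (intro ck_equiv_append ck_equiv_move_right) (auto simp: sorted_wrt_append)
  moreover have "(y # B @ [x]) @ A \<simeq> (B @ [y, x]) @ A"
    using assms by (intro ck_equiv_append ck_equiv_move_left) (auto simp: sorted_wrt_append)
  ultimately show ?thesis by (auto intro: equivclp_sym equivclp_trans)
qed

text \<open>After \<open>x\<close> has travelled left through \<open>A\<close>, the braid move turns
  \<open>x, Suc x, x\<close> into \<open>Suc x, x, Suc x\<close>. This restores the row behind an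
  emitted \<open>Suc x\<close>, which is why special bumping leaves the row unchanged.\<close>

lemma ck_equiv_bump_Suc:
  assumes "sorted_wrt (<) (B @ x # Suc x # A)"
  shows "(B @ x # Suc x # A) @ [x] \<simeq> Suc x # B @ x # Suc x # A"
proof -
  have "(B @ [x]) @ (Suc x # x # A) \<simeq> (B @ [x]) @ (Suc x # A @ [x])"
    using assms by (intro ck_equiv_append ck_equiv_move_right) (auto simp: sorted_wrt_append)
  moreover have "B @ [x, Suc x, x] @ A \<simeq> B @ [Suc x, x, Suc x] @ A"
    by (intro ck_triple_equiv ck_triple.braid)
  moreover have "(Suc x # B @ [x]) @ (Suc x # A) \<simeq> (B @ [Suc x, x]) @ (Suc x # A)"
    using assms by (intro ck_equiv_append ck_equiv_move_left) (auto simp: sorted_wrt_append)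
  ultimately show ?thesis by simp (meson equivclp_sym equivclp_trans)
qed

text \<open>Otherwise every letter behind \<open>x\<close> in the row exceeds \<open>Suc x\<close>
  and commutes with \<open>x\<close>, so the two copies of \<open>x\<close> could be brought
  together.\<close>

lemma Suc_mem_row:
  assumes "sorted_wrt (<) r" "x \<in> set r" "square_free_class (r @ [x])"
  shows "Suc x \<in> set r"
proof (rule ccontr)
  assume no: "Suc x \<notin> set r"
  from assms(2) obtain B A where r: "r = B @ x # A" by (meson split_list)
  have "\<forall>y\<in>set A. Suc x < y \<or> Suc y < x"
    using assms(1) no unfolding r by (auto simp: sorted_wrt_append intro: Suc_lessI)
  then show False
    using not_square_free_commuting[of A x B "[]"] assms(3) unfolding r by simp
qed

text \<open>Mirror image of \<open>ck_equiv_bump\<close>, for the lift: a letter enters a row from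
  the left and ejects to the right the largest letter below it.\<close>

lemma ck_equiv_left_bump:
  assumes "sorted_wrt (<) (S @ s # C)" "s < y" "\<forall>c\<in>set C. y < c"
  shows "y # S @ s # C \<simeq> S @ y # C @ [s]"
proof -
  have "(y # S @ [s]) @ C \<simeq> (S @ [y, s]) @ C"
    using assms by (intro ck_equiv_append ck_equiv_move_left) (auto simp: sorted_wrt_append)
  moreover have "S @ (y # s # C) \<simeq> S @ (y # C @ [s])"
    using assms by (intro ck_equiv_append ck_equiv_move_right) (auto simp: sorted_wrt_append)
  ultimately show ?thesis by (auto intro: equivclp_trans)
qed

lemma ck_equiv_left_bump_Suc:
  assumes "sorted_wrt (<) (S @ s # Suc s # C)"
  shows "Suc s # S @ s # Suc s # C \<simeq> S @ s # Suc s # C @ [s]"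
proof -
  have "(Suc s # S @ [s]) @ (Suc s # C) \<simeq> (S @ [Suc s, s]) @ (Suc s # C)"
    using assms by (intro ck_equiv_append ck_equiv_move_left) (auto simp: sorted_wrt_append)
  moreover have "S @ [s, Suc s, s] @ C \<simeq> S @ [Suc s, s, Suc s] @ C"
    by (intro ck_triple_equiv ck_triple.braid)
  moreover have "(S @ [s]) @ (Suc s # s # C) \<simeq> (S @ [s]) @ (Suc s # C @ [s])"
    using assms by (intro ck_equiv_append ck_equiv_move_right) (auto simp: sorted_wrt_append)
  ultimately show ?thesis by simp (meson equivclp_sym equivclp_trans)
qed

text \<open>Mirror image of \<open>Suc_mem_row\<close>: otherwise every letter of \<open>S\<close>
  is at most a - 2 and the first \<open>a\<close> slides through \<open>S\<close> to the
  second.\<close>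

lemma last_pred_row:
  assumes "sorted_wrt (<) S" "\<forall>s\<in>set S. s < a" "square_free_class (a # S @ a # C)"
  shows "\<exists>S' b. S = S' @ [b] \<and> a = Suc b"
proof (rule ccontr)
  assume no: "\<not> ?thesis"
  have "\<forall>y\<in>set S. Suc a < y \<or> Suc y < a"
  proof (cases S rule: rev_cases)
    case (snoc S' b)
    then have "b < a" "a \<noteq> Suc b" "\<forall>y\<in>set S'. y < b"
      using assms no by (auto simp: sorted_wrt_append)
    then show ?thesis using snoc by auto
  qed simp
  then show False
    using not_square_free_commuting[of S a "[]" C] assms(3) by simp
qed

text \<open>The bottom-row part of \<open>eg_insert\<close>. The bumped letter is returned as a list
  of length at most one, so that an insertion ending in this row fits the same recursion.\<close>

definition row_insert :: "nat list \<Rightarrow> nat \<Rightarrow> nat list \<times> nat list" where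
  "row_insert r x =
    (if \<forall>z\<in>set r. x \<ge> z then (r @ [x], [])
     else let y = Min {z \<in> set r. z > x} in
       (if y = x + 1 \<and> x \<in> set r then r else map (\<lambda>z. if z = y then x else z) r, [y]))"

fun row_insert_word :: "nat list \<Rightarrow> nat list \<Rightarrow> nat list \<times> nat list" where
  "row_insert_word r [] = (r, [])"
| "row_insert_word r (x # w) =
    (let (r1, o1) = row_insert r x; (r2, o2) = row_insert_word r1 w in (r2, o1 @ o2))"

lemma eg_insert_Cons:
  "eg_insert (r # P) x = fst (row_insert r x) # foldl eg_insert P (snd (row_insert r x))"
  by (simp add: row_insert_def Let_def)

text \<open>Insertion can be carried out row by row instead of letter by letter: the whole word
  passes the bottom row before the bumped word enters the rest. This makes induction on the rows
  possible.\<close>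

lemma foldl_eg_insert_Cons:
  "foldl eg_insert (r # P) w =
    fst (row_insert_word r w) # foldl eg_insert P (snd (row_insert_word r w))"
  by (induction w arbitrary: r P) (simp_all add: eg_insert_Cons case_prod_beta Let_def del: eg_insert.simps)

lemma row_insert_append: "\<forall>z\<in>set r. z \<le> x \<Longrightarrow> row_insert r x = (r @ [x], [])"
  by (simp add: row_insert_def)

lemma Min_greater:
  fixes y :: nat
  assumes "finite R" "y \<in> R" "x < y" "\<forall>z\<in>R. x < z \<longrightarrow> y \<le> z"
  shows "Min {z \<in> R. z > x} = y"
  using assms by (intro Min_eqI) auto

lemma row_insert_bump:
  assumes "sorted_wrt (<) (B @ y # A)" "\<forall>b\<in>set B. b < x" "x < y"
  shows "row_insert (B @ y # A) x = (B @ x # A, [y])"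
proof -
  have "Min {z \<in> set (B @ y # A). z > x} = y"
    using assms by (intro Min_greater) (auto simp: sorted_wrt_append)
  moreover have "x \<notin> set (B @ y # A)" using assms by (auto simp: sorted_wrt_append)
  moreover have "map (\<lambda>z. if z = y then x else z) (B @ y # A) = B @ x # A"
    using assms by (auto simp: sorted_wrt_append intro!: map_idI)
  ultimately show ?thesis using assms(3)
    unfolding row_insert_def Let_def by (auto simp del: map_append)
qed

lemma row_insert_bump_Suc:
  assumes "sorted_wrt (<) (B @ x # Suc x # A)"
  shows "row_insert (B @ x # Suc x # A) x = (B @ x # Suc x # A, [Suc x])"
proof -
  have "Min {z \<in> set (B @ x # Suc x # A). z > x} = Suc x"
    using assms by (intro Min_greater) (auto simp: sorted_wrt_append)
  then show ?thesis unfolding row_insert_def Let_def by auto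
qed

text \<open>Square-freeness excludes a row that contains \<open>x\<close> but not
  \<open>Suc x\<close>, where insertion would create a repeated letter.\<close>

lemma row_insert_cases:
  assumes "sorted_wrt (<) r" "square_free_class (r @ [x])"
  obtains (app) "\<forall>z\<in>set r. z < x" "row_insert r x = (r @ [x], [])"
  | (bump) B y A where "r = B @ y # A" "\<forall>b\<in>set B. b < x" "x < y" "row_insert r x = (B @ x # A, [y])"
  | (bump_Suc) B A where "r = B @ x # Suc x # A" "row_insert r x = (r, [Suc x])"
proof (cases "x \<in> set r")
  case True
  then obtain B A where r: "r = B @ x # A" by (meson split_list)
  from Suc_mem_row[OF assms(1) True assms(2)] have "Suc x \<in> set A"
    using assms(1) unfolding r by (auto simp: sorted_wrt_append)
  then obtain a A' where A: "A = a # A'" by (cases A) auto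
  with \<open>Suc x \<in> set A\<close> have "a = Suc x"
    using assms(1) unfolding r by (fastforce simp: sorted_wrt_append)
  then show ?thesis using bump_Suc[of B A'] row_insert_bump_Suc[of B x A'] assms(1) r A by simp
next
  case False
  define B where "B = takeWhile (\<lambda>z. z < x) r"
  define D where "D = dropWhile (\<lambda>z. z < x) r"
  have r: "r = B @ D" by (simp add: B_def D_def)
  have B: "\<forall>b\<in>set B. b < x" unfolding B_def by (auto dest: set_takeWhileD)
  show ?thesis
  proof (cases D)
    case Nil
    then show ?thesis using app r B row_insert_append[of r x] by fastforce
  next
    case (Cons y A)
    then have "\<not> y < x" unfolding D_def by (simp add: dropWhile_eq_Cons_conv)
    with False r Cons have "x < y" by auto
    then show ?thesis using bump row_insert_bump[of B y A x] assms(1) r B Cons by metis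
  qed
qed

lemma row_insert_correct:
  assumes "sorted_wrt (<) r" "square_free_class (r @ [x])"
  shows "sorted_wrt (<) (fst (row_insert r x))"
    and "r @ [x] \<simeq> snd (row_insert r x) @ fst (row_insert r x)"
proof -
  have "sorted_wrt (<) (fst (row_insert r x)) \<and>
    r @ [x] \<simeq> snd (row_insert r x) @ fst (row_insert r x)"
    using assms
  proof (cases rule: row_insert_cases)
    case app
    then show ?thesis using assms(1) by (auto simp: sorted_wrt_append)
  next
    case (bump B y A)
    have "\<forall>a\<in>set A. x < a" using assms(1) bump by (auto simp: sorted_wrt_append)
    then show ?thesis using assms(1) bump ck_equiv_bump[of B y A x]
      by (auto simp: sorted_wrt_append)
  next
    case (bump_Suc B A)
    then show ?thesis using assms(1) ck_equiv_bump_Suc[of B x A] by auto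
  qed
  then show "sorted_wrt (<) (fst (row_insert r x))"
    and "r @ [x] \<simeq> snd (row_insert r x) @ fst (row_insert r x)" by auto
qed

lemma row_insert_word_correct:
  assumes "sorted_wrt (<) r" "square_free_class (r @ w)"
  shows "sorted_wrt (<) (fst (row_insert_word r w)) \<and>
    r @ w \<simeq> snd (row_insert_word r w) @ fst (row_insert_word r w)"
  using assms
proof (induction w arbitrary: r)
  case (Cons x w)
  obtain r1 o1 where 1: "row_insert r x = (r1, o1)" by fastforce
  obtain r2 o2 where 2: "row_insert_word r1 w = (r2, o2)" by fastforce
  have sf: "square_free_class (r @ [x])"
    using Cons.prems(2) square_free_class_prefix[of "r @ [x]" w] by simp
  note row = row_insert_correct[OF Cons.prems(1) sf, unfolded 1, simplified]
  have eq: "r @ x # w \<simeq> o1 @ r1 @ w"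
    using ck_equiv_append[OF row(2), of w w] by simp
  then have "square_free_class (r1 @ w)"
    using Cons.prems(2) square_free_class_ck square_free_class_suffix by blast
  with Cons.IH[OF row(1)] 2 have IH: "sorted_wrt (<) r2" "r1 @ w \<simeq> o2 @ r2" by auto
  have "o1 @ r1 @ w \<simeq> o1 @ o2 @ r2"
    by (rule ck_equiv_append[OF equivclp_refl IH(2)])
  with eq IH show ?case by (auto simp: 1 2 intro: equivclp_trans)
qed simp

section \<open>Invariance of insertion under Coxeter--Knuth equivalence\<close>

text \<open>A strictly increasing row is determined by its set of letters, so the case analysis
  is carried out on sets.\<close>

definition set_insert :: "nat set \<Rightarrow> nat \<Rightarrow> nat set \<times> nat list" where
  "set_insert R x =
    (if \<forall>z\<in>R. z \<le> x then (insert x R, [])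
     else let y = Min {z \<in> R. z > x} in
       (if y = Suc x \<and> x \<in> R then R else insert x (R - {y}), [y]))"

fun set_insert_word :: "nat set \<Rightarrow> nat list \<Rightarrow> nat set \<times> nat list" where
  "set_insert_word R [] = (R, [])"
| "set_insert_word R (x # w) =
    (let (R1, o1) = set_insert R x; (R2, o2) = set_insert_word R1 w in (R2, o1 @ o2))"

definition next_in :: "nat set \<Rightarrow> nat \<Rightarrow> nat \<Rightarrow> bool" where
  "next_in R x y \<longleftrightarrow> y \<in> R \<and> x < y \<and> (\<forall>z\<in>R. x < z \<longrightarrow> y \<le> z)"

lemma set_row_insert:
  "(set (fst (row_insert r x)), snd (row_insert r x)) = set_insert (set r) x"
proof (cases "\<forall>z\<in>set r. z \<le> x")
  case True
  then show ?thesis by (simp add: row_insert_def set_insert_def)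
next
  case False
  then have "Min {z \<in> set r. z > x} \<in> {z \<in> set r. z > x}"
    by (intro Min_in) (auto simp: not_le)
  with False show ?thesis by (auto simp: row_insert_def set_insert_def Let_def)
qed

lemma set_row_insert_word:
  "(set (fst (row_insert_word r w)), snd (row_insert_word r w)) = set_insert_word (set r) w"
proof (induction w arbitrary: r)
  case (Cons x w)
  obtain r1 o1 where 1: "row_insert r x = (r1, o1)" by fastforce
  obtain r2 o2 where 2: "row_insert_word r1 w = (r2, o2)" by fastforce
  have "set_insert (set r) x = (set r1, o1)" "set_insert_word (set r1) w = (set r2, o2)"
    using set_row_insert[of r x] Cons.IH[of r1] by (simp_all add: 1 2)
  then show ?case by (simp add: 1 2)
qed simp

lemma next_in_cases:
  assumes "finite R"
  obtains "\<forall>z\<in>R. z \<le> x" | y where "next_in R x y"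
proof (cases "\<forall>z\<in>R. z \<le> x")
  case False
  then have "Min {z \<in> R. z > x} \<in> {z \<in> R. z > x}"
    using assms by (intro Min_in) (auto simp: not_le)
  then have "next_in R x (Min {z \<in> R. z > x})"
    using assms by (auto simp: next_in_def)
  then show thesis using that by blast
qed (use that in blast)

lemma set_insert_max: "\<forall>z\<in>R. z \<le> x \<Longrightarrow> set_insert R x = (insert x R, [])"
  by (simp add: set_insert_def)

lemma set_insert_next:
  assumes "finite R" "next_in R x y"
  shows "set_insert R x = (if y = Suc x \<and> x \<in> R then R else insert x (R - {y}), [y])"
proof -
  have "Min {z \<in> R. z > x} = y" using assms by (intro Min_greater) (auto simp: next_in_def)
  moreover have "\<not> (\<forall>z\<in>R. z \<le> x)" using assms by (auto simp: next_in_def not_le)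
  ultimately show ?thesis by (simp only: set_insert_def Let_def if_False)
qed

lemma set_insert_Suc:
  "finite R \<Longrightarrow> x \<in> R \<Longrightarrow> Suc x \<in> R \<Longrightarrow> set_insert R x = (R, [Suc x])"
  using set_insert_next[of R x "Suc x"] by (simp add: next_in_def Suc_le_eq)

lemma set_insert_bump:
  "finite R \<Longrightarrow> next_in R x y \<Longrightarrow> y \<noteq> Suc x \<or> x \<notin> R \<Longrightarrow> set_insert R x = (insert x (R - {y}), [y])"
  using set_insert_next[of R x y] by auto

lemma set_insert_word3:
  assumes "set_insert R a = (R1, o1)" "set_insert R1 b = (R2, o2)" "set_insert R2 c = (R3, o3)"
  shows "set_insert_word R [a, b, c] = (R3, o1 @ o2 @ o3)"
  using assms by simp

lemma set_insert_props:
  assumes "finite R" "set_insert R x = (R', u)"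
  obtains "\<forall>z\<in>R. z \<le> x" "R' = insert x R" "u = []"
  | y where "next_in R x y" "u = [y]" "R' = insert x (R - {y})" "y \<noteq> Suc x \<or> x \<notin> R"
  | "x \<in> R" "Suc x \<in> R" "u = [Suc x]" "R' = R"
proof (cases rule: next_in_cases[OF assms(1), of x])
  case 1
  then show ?thesis using that(1) assms set_insert_max[of R x] by auto
next
  case (2 y)
  show ?thesis
  proof (cases "y = Suc x \<and> x \<in> R")
    case True
    then show ?thesis using that(3) set_insert_next[OF assms(1) 2] assms(2) 2
      by (auto simp: next_in_def)
  next
    case False
    then show ?thesis using that(2) set_insert_next[OF assms(1) 2] assms(2) 2
      by (auto simp: next_in_def)
  qed
qed

text \<open>The two insertions affect disjoint ranges of letters: that of \<open>a\<close> nothing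
  above \<open>p\<close>, that of \<open>c\<close> nothing below \<open>c\<close>. The last clauses
  locate the letter bumped by a third insertion.\<close>

lemma set_insert_commute:
  assumes fin: "finite R" and p: "next_in R a p" "p < c"
  obtains Ra Rc R' u where
    "set_insert R a = (Ra, [p])" "set_insert Ra c = (R', u)"
    "set_insert R c = (Rc, u)" "set_insert Rc a = (R', [p])"
    "R' \<subseteq> insert a (insert c R)" "p \<notin> R' \<or> p = Suc a" "c \<in> R'"
    "u = [] \<or> (\<exists>q. u = [q] \<and> c < q)"
proof -
  define Ra where "Ra = (if p = Suc a \<and> a \<in> R then R else insert a (R - {p}))"
  have a: "set_insert R a = (Ra, [p])" using set_insert_next[OF fin p(1)] by (simp add: Ra_def)
  have finRa: "finite Ra" using fin by (simp add: Ra_def)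
  have ac: "a < p" using p by (simp add: next_in_def)
  show thesis
  proof (cases rule: next_in_cases[OF fin, of c])
    case 1
    then have Rc: "set_insert R c = (insert c R, [])" by (rule set_insert_max)
    have Ra_c: "set_insert Ra c = (insert c Ra, [])"
      using 1 p ac by (intro set_insert_max) (auto simp: Ra_def)
    have "next_in (insert c R) a p" using p ac by (auto simp: next_in_def)
    then have "set_insert (insert c R) a = (insert c Ra, [p])"
      using set_insert_next[of "insert c R" a p] fin p ac by (auto simp: Ra_def insert_commute)
    then show thesis using p ac by (intro that[OF a Ra_c Rc]) (auto simp: Ra_def)
  next
    case (2 q)
    define Rc where "Rc = (if q = Suc c \<and> c \<in> R then R else insert c (R - {q}))"
    define R' where "R' = (if q = Suc c \<and> c \<in> R then Ra else insert c (Ra - {q}))"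
    have cq: "c < q" using 2 by (simp add: next_in_def)
    have c: "set_insert R c = (Rc, [q])" using set_insert_next[OF fin 2] by (simp add: Rc_def)
    have "next_in Ra c q" using 2 p ac cq by (auto simp: next_in_def Ra_def)
    then have Ra_c: "set_insert Ra c = (R', [q])"
      using set_insert_next[OF finRa] p ac cq by (auto simp: R'_def Ra_def)
    have "next_in Rc a p" using p ac cq by (auto simp: next_in_def Rc_def)
    then have "set_insert Rc a = (R', [p])"
      using set_insert_next[of Rc a p] fin p ac cq by (auto simp: Rc_def R'_def Ra_def)
    then show thesis using p ac cq
      by (intro that[OF a Ra_c c]) (auto simp: Ra_def R'_def)
  qed
qed

abbreviation same_insertion :: "nat set \<Rightarrow> nat list \<Rightarrow> nat list \<Rightarrow> bool" where
  "same_insertion R w w' \<equiv> fst (set_insert_word R w) = fst (set_insert_word R w') \<and>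
    (snd (set_insert_word R w) = snd (set_insert_word R w') \<or>
     ck_triple (snd (set_insert_word R w)) (snd (set_insert_word R w')) \<or>
     ck_triple (snd (set_insert_word R w')) (snd (set_insert_word R w)))"

text \<open>Once \<open>b\<close> lies in the row, \<open>a\<close> bumps some \<open>p\<close> with
  p \<le> b < c, so the insertions of \<open>a\<close> and \<open>c\<close> commute. If
  \<open>c\<close> bumps a letter \<open>q\<close>, then \<open>b\<close> has bumped some
  \<open>r\<close> with \<open>p < r < q\<close>, and the bumped words \<open>r p q\<close> and
  \<open>r q p\<close> form a triple of the same kind.\<close>

lemma set_insert_bac_bca:
  assumes fin: "finite R" and "a < b" "b < c"
  shows "same_insertion R [b, a, c] [b, c, a]"
proof -
  obtain R1 v where b: "set_insert R b = (R1, v)" by fastforce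
  \<comment> \<open>The alternative \<open>r = Suc b\<close> is special bumping, where
    \<open>r\<close> stays in the row; then \<open>r < q\<close> follows from r \<le> c < q
    instead.\<close>
  have R1: "finite R1 \<and> b \<in> R1 \<and>
      (v = [] \<and> (\<forall>z\<in>R1. z \<le> b) \<or> (\<exists>r. v = [r] \<and> b < r \<and> (\<forall>z\<in>R1. b < z \<longrightarrow> r < z \<or> r = Suc b)))"
    using fin b by (rule set_insert_props) (use fin in \<open>auto simp: next_in_def le_less\<close>)
  obtain p where p: "next_in R1 a p" "p \<le> b"
  proof (cases rule: next_in_cases[OF R1[THEN conjunct1], of a])
    case (2 y)
    then have "y \<le> b" using assms R1 by (simp add: next_in_def)
    with 2 show ?thesis using that by blast
  qed (use R1 assms in auto)
  with assms have "p < c" by simp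
  then obtain Ra Rc R' u where acs: "set_insert R1 a = (Ra, [p])" "set_insert Ra c = (R', u)"
    "set_insert R1 c = (Rc, u)" "set_insert Rc a = (R', [p])"
    "u = [] \<or> (\<exists>q. u = [q] \<and> c < q)"
    using set_insert_commute[of R1 a p c] R1 p by metis
  have w: "set_insert_word R [b, a, c] = (R', v @ [p] @ u)"
    "set_insert_word R [b, c, a] = (R', v @ u @ [p])"
    using b acs by (auto intro: set_insert_word3)
  show ?thesis
  proof (cases u)
    case Nil
    then show ?thesis unfolding w by simp
  next
    case (Cons q u')
    with acs have u: "u = [q]" "c < q" by auto
    have q: "next_in R1 c q"
      using acs(3) R1 u by (auto elim!: set_insert_props simp: next_in_def Suc_le_eq)
    then obtain r where r: "v = [r]" "b < r" "r < q \<or> r = Suc b"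
      using R1 assms u by (fastforce simp: next_in_def)
    then have "r < q" using assms u by auto
    then show ?thesis unfolding w u r
      using ck_triple.bac_bca[of p r q] p r by simp
  qed
qed

text \<open>The kind of triple may change, depending on the letter \<open>p\<close> bumped by
  \<open>a\<close>. If \<open>p < c\<close>, the insertions of \<open>a\<close> and \<open>c\<close>
  commute and the kind is kept. If \<open>p = c\<close>, the bumped words form a braid triple on
  \<open>c\<close>. If \<open>p > c\<close>, they are \<open>p q c\<close> and \<open>p c q\<close>,
  with \<open>q\<close> the next row letter after \<open>p\<close>, or agree when there is no
  \<open>q\<close>. If \<open>a\<close> bumps nothing, both words bump just
  \<open>c\<close>.\<close>

lemma set_insert_acb_cab:
  assumes fin: "finite R" and "a < b" "b < c"
    and sf: "a \<in> R \<Longrightarrow> Suc a \<in> R" "c \<in> R \<Longrightarrow> Suc c \<in> R"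
  shows "same_insertion R [a, c, b] [c, a, b]"
proof (cases rule: next_in_cases[OF fin, of a])
  case 1
  with sf have "a \<notin> R" by fastforce
  have R: "\<forall>z\<in>R. z < a" using 1 \<open>a \<notin> R\<close> by (metis le_neq_implies_less)
  have "set_insert R a = (insert a R, [])" using 1 by (rule set_insert_max)
  moreover have "set_insert (insert a R) c = (insert c (insert a R), [])"
    using R assms by (intro set_insert_max) auto
  moreover have "set_insert (insert c (insert a R)) b = (insert b (insert a R), [c])"
  proof -
    have "set_insert (insert c (insert a R)) b = (insert b (insert c (insert a R) - {c}), [c])"
      using R assms by (intro set_insert_bump) (auto simp: next_in_def)
    moreover have "insert b (insert c (insert a R) - {c}) = insert b (insert a R)"
      using R assms by auto
    ultimately show ?thesis by simp
  qed
  ultimately have 1: "set_insert_word R [a, c, b] = (insert b (insert a R), [] @ [] @ [c])"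
    by (rule set_insert_word3)
  have "set_insert R c = (insert c R, [])"
    using R assms by (intro set_insert_max) auto
  moreover have "set_insert (insert c R) a = (insert a R, [c])"
  proof -
    have "set_insert (insert c R) a = (insert a (insert c R - {c}), [c])"
      using R assms by (intro set_insert_bump) (auto simp: next_in_def)
    moreover have "insert a (insert c R - {c}) = insert a R"
      using R assms by auto
    ultimately show ?thesis by simp
  qed
  moreover have "set_insert (insert a R) b = (insert b (insert a R), [])"
    using R assms by (intro set_insert_max) auto
  ultimately have 2: "set_insert_word R [c, a, b] = (insert b (insert a R), [] @ [c] @ [])"
    by (rule set_insert_word3)
  show ?thesis unfolding 1 2 by simp
next
  case (2 p)
  note p = 2
  consider (gt) "c < p" | (eq) "p = c" | (lt) "p < c" by linarith
  then show ?thesis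
  proof cases
    case gt
    have a: "a \<notin> R" using sf(1) gt p assms by (fastforce simp: next_in_def)
    have gap: "z \<le> a \<or> p \<le> z" if "z \<in> R" for z using p that by (auto simp: next_in_def)
    have pR: "p \<in> R" using p by (simp add: next_in_def)
    have sa: "set_insert R a = (insert a (R - {p}), [p])"
      using fin p a by (intro set_insert_bump) auto
    have sc: "set_insert R c = (insert c (R - {p}), [p])"
      using fin p gt assms gap by (intro set_insert_bump) (fastforce simp: next_in_def)+
    have "set_insert (insert c (R - {p})) a = (insert a (insert c (R - {p}) - {c}), [c])"
      using fin gt assms gap a by (intro set_insert_bump) (fastforce simp: next_in_def)+
    moreover have "insert a (insert c (R - {p}) - {c}) = insert a (R - {p})"
      using gap gt assms by fastforce
    ultimately have sca: "set_insert (insert c (R - {p})) a = (insert a (R - {p}), [c])" by simp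
    show ?thesis
    proof (cases rule: next_in_cases[OF finite_Diff[OF fin, of "{p}"], of p])
      case 1
      have R: "z = p \<or> z \<le> a" if "z \<in> R" for z
        using 1 gap[OF that] that by force
      have "set_insert (insert a (R - {p})) c = (insert c (insert a (R - {p})), [])"
        using R assms by (intro set_insert_max) fastforce
      moreover have "set_insert (insert c (insert a (R - {p}))) b =
          (insert b (insert c (insert a (R - {p})) - {c}), [c])"
        using R assms fin by (intro set_insert_bump) (fastforce simp: next_in_def)+
      moreover have "insert b (insert c (insert a (R - {p})) - {c}) = insert b (insert a (R - {p}))"
        using R assms by fastforce
      ultimately have w1: "set_insert_word R [a, c, b] = (insert b (insert a (R - {p})), [p] @ [] @ [c])"
        using sa by (metis set_insert_word3)
      have "set_insert (insert a (R - {p})) b = (insert b (insert a (R - {p})), [])"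
        using R assms by (intro set_insert_max) fastforce
      then have w2: "set_insert_word R [c, a, b] = (insert b (insert a (R - {p})), [p] @ [c] @ [])"
        using sc sca by (metis set_insert_word3)
      show ?thesis unfolding w1 w2 by simp
    next
      case (2 q)
      have q: "q \<in> R" "p < q" using 2 by (auto simp: next_in_def)
      have gap2: "z \<le> a \<or> z = p \<or> q \<le> z" if "z \<in> R" for z
        using gap[OF that] 2 that by (cases "z = p") (auto simp: next_in_def)
      have "set_insert (insert a (R - {p})) c = (insert c (insert a (R - {p}) - {q}), [q])"
        using fin q gt assms gap2 by (intro set_insert_bump) (fastforce simp: next_in_def)+
      moreover have "set_insert (insert c (insert a (R - {p}) - {q})) b =
          (insert b (insert c (insert a (R - {p}) - {q}) - {c}), [c])"
        using fin q gt assms gap2 by (intro set_insert_bump) (fastforce simp: next_in_def)+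
      moreover have "insert b (insert c (insert a (R - {p}) - {q}) - {c}) =
          insert b (insert a (R - {p}) - {q})"
        using q gt assms gap2 by fastforce
      ultimately have w1: "set_insert_word R [a, c, b] =
          (insert b (insert a (R - {p}) - {q}), [p] @ [q] @ [c])"
        using sa by (metis set_insert_word3)
      have "set_insert (insert a (R - {p})) b = (insert b (insert a (R - {p}) - {q}), [q])"
        using fin q gt assms gap2 by (intro set_insert_bump) (fastforce simp: next_in_def)+
      then have w2: "set_insert_word R [c, a, b] =
          (insert b (insert a (R - {p}) - {q}), [p] @ [c] @ [q])"
        using sc sca by (metis set_insert_word3)
      show ?thesis unfolding w1 w2 using ck_triple.bac_bca[of c p q] gt q by simp
    qed
  next
    case eq
    have cR: "c \<in> R" "Suc c \<in> R" using p eq sf by (auto simp: next_in_def)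
    have gap: "z \<le> a \<or> c \<le> z" if "z \<in> R" for z using p eq that by (auto simp: next_in_def)
    have "set_insert R a = (insert a (R - {c}), [c])"
      using fin p eq assms by (intro set_insert_bump) auto
    moreover have "set_insert (insert a (R - {c})) c =
        (insert c (insert a (R - {c}) - {Suc c}), [Suc c])"
      using fin cR assms gap by (intro set_insert_bump) (fastforce simp: next_in_def)+
    moreover have "set_insert (insert c (insert a (R - {c}) - {Suc c})) b =
        (insert b (insert c (insert a (R - {c}) - {Suc c}) - {c}), [c])"
      using fin cR assms gap by (intro set_insert_bump) (fastforce simp: next_in_def)+
    moreover have "insert b (insert c (insert a (R - {c}) - {Suc c}) - {c}) =
        insert b (insert a (R - {c}) - {Suc c})"
      using assms by fastforce
    ultimately have w1: "set_insert_word R [a, c, b] =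
        (insert b (insert a (R - {c}) - {Suc c}), [c] @ [Suc c] @ [c])"
      by (metis set_insert_word3)
    have "set_insert R c = (R, [Suc c])" using fin cR by (intro set_insert_Suc)
    moreover have "set_insert R a = (insert a (R - {c}), [c])"
      using fin p eq assms by (intro set_insert_bump) auto
    moreover have "set_insert (insert a (R - {c})) b =
        (insert b (insert a (R - {c}) - {Suc c}), [Suc c])"
      using fin cR assms gap by (intro set_insert_bump) (fastforce simp: next_in_def)+
    ultimately have w2: "set_insert_word R [c, a, b] =
        (insert b (insert a (R - {c}) - {Suc c}), [Suc c] @ [c] @ [Suc c])"
      by (metis set_insert_word3)
    show ?thesis unfolding w1 w2 using ck_triple.braid[of c] by simp
  next
    case lt
    obtain Ra Rc R' u where acs: "set_insert R a = (Ra, [p])" "set_insert Ra c = (R', u)"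
      "set_insert R c = (Rc, u)" "set_insert Rc a = (R', [p])"
      "R' \<subseteq> insert a (insert c R)" "p \<notin> R' \<or> p = Suc a" "c \<in> R'"
      "u = [] \<or> (\<exists>q. u = [q] \<and> c < q)"
      using set_insert_commute[OF fin p lt] by metis
    have fin': "finite R'" using acs(5) fin by (simp add: finite_subset)
    obtain m where m: "next_in R' b m" "m \<le> c"
    proof (cases rule: next_in_cases[OF fin', of b])
      case (2 y)
      then have "y \<le> c" using assms acs(7) by (simp add: next_in_def)
      with 2 show ?thesis using that by blast
    qed (use acs(7) assms in auto)
    \<comment> \<open>Either \<open>p\<close> has left the row or it equals \<open>Suc a\<close>,
      which is at most \<open>b\<close>; in both cases the letter bumped by \<open>b\<close> lies
      above it.\<close>
    have pm: "p < m"
    proof -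
      have "m \<in> R'" "a < m" "b < m" using m assms by (auto simp: next_in_def)
      then have "m = c \<or> m \<in> R" using acs(5) by auto
      then have "p \<le> m" using p lt \<open>a < m\<close> by (auto simp: next_in_def)
      moreover have "m \<noteq> p" using \<open>m \<in> R'\<close> acs(6) \<open>b < m\<close> assms by auto
      ultimately show ?thesis by simp
    qed
    obtain R'' where b: "set_insert R' b = (R'', [m])"
      using set_insert_next[OF fin' m(1)] by blast
    have w: "set_insert_word R [a, c, b] = (R'', [p] @ u @ [m])"
      "set_insert_word R [c, a, b] = (R'', u @ [p] @ [m])"
      using acs b by (auto intro: set_insert_word3)
    from acs(8) show ?thesis
      unfolding w using ck_triple.acb_cab[of p m] pm m(2) by fastforce
  qed
qed

text \<open>If \<open>x\<close> bumps \<open>Suc x\<close>, the bumped words form a braid triple on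
  \<open>Suc x\<close>. If it bumps a larger \<open>p\<close>, they are \<open>p q (Suc x)\<close>
  and \<open>p (Suc x) q\<close>, or agree when the row has no letter \<open>q\<close> above
  \<open>p\<close>.\<close>

lemma set_insert_braid:
  assumes fin: "finite R"
    and sf: "x \<in> R \<Longrightarrow> Suc x \<in> R" "Suc x \<in> R \<Longrightarrow> Suc (Suc x) \<in> R"
  shows "same_insertion R [x, Suc x, x] [Suc x, x, Suc x]"
proof (cases rule: next_in_cases[OF fin, of x])
  case 1
  with sf have "x \<notin> R" by fastforce
  have R: "\<forall>z\<in>R. z < x" using 1 \<open>x \<notin> R\<close> by (metis le_neq_implies_less)
  have "set_insert R x = (insert x R, [])" using 1 by (rule set_insert_max)
  moreover have "set_insert (insert x R) (Suc x) = (insert (Suc x) (insert x R), [])"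
    using R by (intro set_insert_max) auto
  moreover have "set_insert (insert (Suc x) (insert x R)) x = (insert (Suc x) (insert x R), [Suc x])"
    using fin by (intro set_insert_Suc) auto
  ultimately have w1: "set_insert_word R [x, Suc x, x] = (insert (Suc x) (insert x R), [] @ [] @ [Suc x])"
    by (rule set_insert_word3)
  have "set_insert R (Suc x) = (insert (Suc x) R, [])"
    using R by (intro set_insert_max) auto
  moreover have "set_insert (insert (Suc x) R) x = (insert x (insert (Suc x) R - {Suc x}), [Suc x])"
    using R fin \<open>x \<notin> R\<close> by (intro set_insert_bump) (auto simp: next_in_def)
  moreover have "insert x (insert (Suc x) R - {Suc x}) = insert x R"
    using R by auto
  moreover have "set_insert (insert x R) (Suc x) = (insert (Suc x) (insert x R), [])"
    using R by (intro set_insert_max) auto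
  ultimately have w2: "set_insert_word R [Suc x, x, Suc x] =
      (insert (Suc x) (insert x R), [] @ [Suc x] @ [])"
    by (metis set_insert_word3)
  show ?thesis unfolding w1 w2 by simp
next
  case (2 p)
  note p = 2
  show ?thesis
  proof (cases "p = Suc x")
    case True
    then have R: "Suc x \<in> R" "Suc (Suc x) \<in> R" using p sf by (auto simp: next_in_def)
    show ?thesis
    proof (cases "x \<in> R")
      case True
      have "set_insert_word R [x, Suc x, x] = (R, [Suc x] @ [Suc (Suc x)] @ [Suc x])"
        "set_insert_word R [Suc x, x, Suc x] = (R, [Suc (Suc x)] @ [Suc x] @ [Suc (Suc x)])"
        using fin True R by (simp_all add: set_insert_Suc)
      then show ?thesis using ck_triple.braid[of "Suc x"] by simp
    next
      case False
      have nx: "next_in R x (Suc x)" using p True \<open>p = Suc x\<close> by simp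
      have "set_insert R x = (insert x (R - {Suc x}), [Suc x])"
        using fin nx False by (intro set_insert_bump) auto
      moreover have s2: "set_insert (insert x (R - {Suc x})) (Suc x) =
          (insert (Suc x) (insert x (R - {Suc x}) - {Suc (Suc x)}), [Suc (Suc x)])"
        using fin R by (intro set_insert_bump) (auto simp: next_in_def)
      moreover have "set_insert (insert (Suc x) (insert x (R - {Suc x}) - {Suc (Suc x)})) x =
          (insert (Suc x) (insert x (R - {Suc x}) - {Suc (Suc x)}), [Suc x])"
        using fin by (intro set_insert_Suc) auto
      ultimately have w1: "set_insert_word R [x, Suc x, x] =
          (insert (Suc x) (insert x (R - {Suc x}) - {Suc (Suc x)}), [Suc x] @ [Suc (Suc x)] @ [Suc x])"
        by (rule set_insert_word3)
      have "set_insert R (Suc x) = (R, [Suc (Suc x)])"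
        using fin R by (intro set_insert_Suc) auto
      moreover have "set_insert R x = (insert x (R - {Suc x}), [Suc x])"
        using fin nx False by (intro set_insert_bump) auto
      ultimately have w2: "set_insert_word R [Suc x, x, Suc x] =
          (insert (Suc x) (insert x (R - {Suc x}) - {Suc (Suc x)}),
           [Suc (Suc x)] @ [Suc x] @ [Suc (Suc x)])"
        using s2 by (rule set_insert_word3)
      show ?thesis unfolding w1 w2 using ck_triple.braid[of "Suc x"] by simp
    qed
  next
    case False
    have gt: "Suc x < p" using p False by (auto simp: next_in_def)
    have gap: "z < x \<or> p \<le> z" if "z \<in> R" for z
      using p that False sf(1) by (cases "z = x") (force simp: next_in_def)+
    have pR: "p \<in> R" using p by (simp add: next_in_def)
    have sa: "set_insert R x = (insert x (R - {p}), [p])"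
      using fin p False by (intro set_insert_bump) auto
    have sc: "set_insert R (Suc x) = (insert (Suc x) (R - {p}), [p])"
      using fin pR gt gap by (intro set_insert_bump) (fastforce simp: next_in_def)+
    have "set_insert (insert (Suc x) (R - {p})) x =
        (insert x (insert (Suc x) (R - {p}) - {Suc x}), [Suc x])"
      using fin gt gap by (intro set_insert_bump) (fastforce simp: next_in_def)+
    moreover have "insert x (insert (Suc x) (R - {p}) - {Suc x}) = insert x (R - {p})"
      using gap gt by fastforce
    ultimately have sca: "set_insert (insert (Suc x) (R - {p})) x = (insert x (R - {p}), [Suc x])"
      by simp
    show ?thesis
    proof (cases rule: next_in_cases[OF finite_Diff[OF fin, of "{p}"], of p])
      case 1
      have R: "z = p \<or> z < x" if "z \<in> R" for z
        using 1 gap[OF that] that by force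
      have s: "set_insert (insert x (R - {p})) (Suc x) = (insert (Suc x) (insert x (R - {p})), [])"
        using R by (intro set_insert_max) fastforce
      moreover have "set_insert (insert (Suc x) (insert x (R - {p}))) x =
          (insert (Suc x) (insert x (R - {p})), [Suc x])"
        using fin by (intro set_insert_Suc) auto
      ultimately have w1: "set_insert_word R [x, Suc x, x] =
          (insert (Suc x) (insert x (R - {p})), [p] @ [] @ [Suc x])"
        using sa by (metis set_insert_word3)
      have w2: "set_insert_word R [Suc x, x, Suc x] =
          (insert (Suc x) (insert x (R - {p})), [p] @ [Suc x] @ [])"
        using sc sca s by (rule set_insert_word3)
      show ?thesis unfolding w1 w2 by simp
    next
      case (2 q)
      have q: "q \<in> R" "p < q" using 2 by (auto simp: next_in_def)
      have gap2: "z < x \<or> z = p \<or> q \<le> z" if "z \<in> R" for z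
        using gap[OF that] 2 that by (cases "z = p") (auto simp: next_in_def)
      have s: "set_insert (insert x (R - {p})) (Suc x) =
          (insert (Suc x) (insert x (R - {p}) - {q}), [q])"
        using fin q gt gap2 by (intro set_insert_bump) (fastforce simp: next_in_def)+
      moreover have "set_insert (insert (Suc x) (insert x (R - {p}) - {q})) x =
          (insert (Suc x) (insert x (R - {p}) - {q}), [Suc x])"
        using fin q gt by (intro set_insert_Suc) auto
      ultimately have w1: "set_insert_word R [x, Suc x, x] =
          (insert (Suc x) (insert x (R - {p}) - {q}), [p] @ [q] @ [Suc x])"
        using sa by (metis set_insert_word3)
      have w2: "set_insert_word R [Suc x, x, Suc x] =
          (insert (Suc x) (insert x (R - {p}) - {q}), [p] @ [Suc x] @ [q])"
        using sc sca s by (rule set_insert_word3)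
      show ?thesis unfolding w1 w2 using ck_triple.bac_bca[of "Suc x" p q] gt q by simp
    qed
  qed
qed

text \<open>\<open>Suc_mem_row\<close>, applied to the first letter of each of the two words,
  supplies the closure hypotheses of the set version.\<close>

lemma row_insert_word_ck_triple:
  assumes r: "sorted_wrt (<) r" and sf: "square_free_class (r @ w)" and w: "ck_triple w w'"
  shows "fst (row_insert_word r w) = fst (row_insert_word r w')"
    and "snd (row_insert_word r w) = snd (row_insert_word r w') \<or>
      ck_triple (snd (row_insert_word r w)) (snd (row_insert_word r w')) \<or>
      ck_triple (snd (row_insert_word r w')) (snd (row_insert_word r w))"
proof -
  have sf': "square_free_class (r @ w')"
    using sf square_free_class_ck[OF ck_triple_equiv[OF w, of r "[]"]] by simp
  have Suc_mem: "Suc z \<in> set r" if "z \<in> set r" "square_free_class (r @ z # v)" for z v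
    using that square_free_class_prefix[of "r @ [z]" v] Suc_mem_row[OF r] by simp
  from w have "same_insertion (set r) w w'"
  proof (cases rule: ck_triple.cases)
    case (bac_bca a b c)
    then show ?thesis using set_insert_bac_bca by simp
  next
    case (acb_cab a b c)
    then show ?thesis using set_insert_acb_cab[of "set r" a b c] Suc_mem sf sf' by blast
  next
    case (braid x)
    then show ?thesis using set_insert_braid[of "set r" x] Suc_mem sf sf' by blast
  qed
  moreover have "sorted_wrt (<) (fst (row_insert_word r w))" "sorted_wrt (<) (fst (row_insert_word r w'))"
    using row_insert_word_correct r sf sf' by blast+
  ultimately show "fst (row_insert_word r w) = fst (row_insert_word r w')"
    and "snd (row_insert_word r w) = snd (row_insert_word r w') \<or>
      ck_triple (snd (row_insert_word r w)) (snd (row_insert_word r w')) \<or>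
      ck_triple (snd (row_insert_word r w')) (snd (row_insert_word r w))"
    by (auto simp flip: set_row_insert_word intro: strict_sorted_equal)
qed

section \<open>The insertion tableau\<close>

abbreviation increasing_rows :: "nat list list \<Rightarrow> bool" where
  "increasing_rows R \<equiv> \<forall>r\<in>set R. sorted_wrt (<) r"

definition eg_tableau :: "nat list \<Rightarrow> nat list list" where
  "eg_tableau w = foldl eg_insert [] w"

lemma row_reading_word_Nil [simp]: "row_reading_word [] = []"
  by (simp add: row_reading_word_def)

lemma row_reading_word_Cons [simp]: "row_reading_word (r # P) = row_reading_word P @ r"
  by (simp add: row_reading_word_def)

lemma eg_insert_correct:
  assumes "increasing_rows P" "square_free_class (row_reading_word P @ [x])"
  shows "increasing_rows (eg_insert P x) \<and>
    row_reading_word P @ [x] \<simeq> row_reading_word (eg_insert P x)"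
  using assms
proof (induction P arbitrary: x)
  case (Cons r P)
  have r: "sorted_wrt (<) r" "square_free_class (r @ [x])"
    using Cons.prems square_free_class_suffix[of "row_reading_word P" "r @ [x]"] by auto
  let ?W = "row_reading_word P"
  consider (app) "row_insert r x = (r @ [x], [])" | (bump) r' y where "row_insert r x = (r', [y])"
    using r by (rule row_insert_cases) blast+
  then show ?case
  proof cases
    case app
    then show ?thesis
      using Cons.prems(1) row_insert_correct(1)[OF r]
      by (auto simp: eg_insert_Cons simp del: eg_insert.simps)
  next
    case bump
    note correct = row_insert_correct[OF r, unfolded bump, simplified]
    from ck_equiv_append[OF equivclp_refl correct(2), of ?W]
    have 1: "?W @ r @ [x] \<simeq> (?W @ [y]) @ r'" by simp
    have "square_free_class (?W @ r @ [x])" using Cons.prems(2) by simp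
    from square_free_class_prefix[OF square_free_class_ck[OF 1 this]]
    have IH: "increasing_rows (eg_insert P y)"
      "?W @ [y] \<simeq> row_reading_word (eg_insert P y)" using Cons by auto
    from ck_equiv_append[OF IH(2) equivclp_refl, of r'] 1
    have "?W @ r @ [x] \<simeq> row_reading_word (eg_insert P y) @ r'" by (rule equivclp_trans[rotated])
    then show ?thesis using IH(1) correct(1)
      by (auto simp: eg_insert_Cons bump simp del: eg_insert.simps)
  qed
qed simp

lemma foldl_eg_insert_correct:
  assumes "increasing_rows P" "square_free_class (row_reading_word P @ w)"
  shows "increasing_rows (foldl eg_insert P w) \<and>
    row_reading_word P @ w \<simeq> row_reading_word (foldl eg_insert P w)"
  using assms
proof (induction w arbitrary: P)
  case (Cons x w)
  have "square_free_class (row_reading_word P @ [x])"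
    using Cons.prems(2) square_free_class_prefix[of "row_reading_word P @ [x]" w] by simp
  then have ins: "increasing_rows (eg_insert P x)"
    "row_reading_word P @ [x] \<simeq> row_reading_word (eg_insert P x)"
    using eg_insert_correct Cons.prems(1) by blast+
  from ck_equiv_append[OF ins(2) equivclp_refl, of w]
  have eq: "row_reading_word P @ x # w \<simeq> row_reading_word (eg_insert P x) @ w" by simp
  then have "square_free_class (row_reading_word (eg_insert P x) @ w)"
    using Cons.prems(2) square_free_class_ck by blast
  then show ?case using Cons.IH[OF ins(1)] eq by (auto intro: equivclp_trans)
qed simp

lemma eg_tableau_correct:
  assumes "square_free_class w"
  shows "increasing_rows (eg_tableau w)" "w \<simeq> row_reading_word (eg_tableau w)"
  using foldl_eg_insert_correct[of "[]" w] assms by (auto simp: eg_tableau_def)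

text \<open>Adding an empty row makes \<open>foldl_eg_insert_Cons\<close> applicable at the top of a
  tableau.\<close>

lemma foldl_eg_insert_Nil: "w \<noteq> [] \<Longrightarrow> foldl eg_insert [] w = foldl eg_insert [[]] w"
  by (cases w) simp_all

text \<open>The first letter inserted into an empty row bumps nothing. Three letters therefore bump
  at most two, too few for a triple.\<close>

lemma length_snd_row_insert_word_Nil: "length (snd (row_insert_word [] w)) \<le> length w - 1"
proof (cases w)
  case (Cons x v)
  have "length (snd (row_insert_word r u)) \<le> length u" for r u
  proof (induction u arbitrary: r)
    case (Cons z u)
    have "length (snd (row_insert r z)) \<le> 1" by (simp add: row_insert_def Let_def)
    then show ?case
      using Cons[of "fst (row_insert r z)"] by (simp add: case_prod_beta Let_def)
  qed simp
  then show ?thesis using Cons by (simp add: row_insert_append split: prod.split)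
qed simp

lemma ck_triple_length: "ck_triple w w' \<Longrightarrow> length w = 3 \<and> length w' = 3"
  by (induction rule: ck_triple.induct) auto

text \<open>Each row is left identical and passes on either equal words or a triple, possibly
  reversed. Above the last row the bumped words are too short to form a triple, so they
  agree.\<close>

lemma foldl_eg_insert_ck_triple:
  assumes "increasing_rows P" "square_free_class (row_reading_word P @ w)" "ck_triple w w'"
  shows "foldl eg_insert P w = foldl eg_insert P w'"
  using assms
proof (induction P arbitrary: w w')
  case Nil
  have len: "length w = 3" "length w' = 3" using ck_triple_length Nil(3) by blast+
  have sf: "square_free_class ([] @ w)" using Nil(2) by simp
  have "length (snd (row_insert_word [] w)) \<le> 2" "length (snd (row_insert_word [] w')) \<le> 2"
    using length_snd_row_insert_word_Nil[of w] length_snd_row_insert_word_Nil[of w'] len by auto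
  then have "row_insert_word [] w = row_insert_word [] w'"
    using row_insert_word_ck_triple[OF _ sf Nil(3)] ck_triple_length
    by (metis le_zero_eq length_greater_0_conv not_less_eq_eq numeral_2_eq_2 numeral_3_eq_3
        order_refl prod_eqI sorted_wrt.simps(1))
  moreover have "foldl eg_insert [] w = foldl eg_insert [[]] w" "foldl eg_insert [] w' = foldl eg_insert [[]] w'"
    using len by (auto intro!: foldl_eg_insert_Nil simp del: eg_insert.simps)
  ultimately show ?case by (simp only: foldl_eg_insert_Cons)
next
  case (Cons r P)
  have r: "sorted_wrt (<) r" "square_free_class (r @ w)"
    using Cons.prems square_free_class_suffix[of "row_reading_word P" "r @ w"] by auto
  have r': "square_free_class (r @ w')"
    using r(2) square_free_class_ck[OF ck_triple_equiv[OF Cons.prems(3), of r "[]"]] by simp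
  have sf: "square_free_class (row_reading_word P @ snd (row_insert_word r v))"
    if "square_free_class (r @ v)" "square_free_class (row_reading_word P @ r @ v)" for v
  proof -
    have "row_reading_word P @ r @ v \<simeq>
        row_reading_word P @ snd (row_insert_word r v) @ fst (row_insert_word r v)"
      using row_insert_word_correct[OF r(1) that(1)] by (intro ck_equiv_append[OF equivclp_refl]) auto
    then show ?thesis
      using that(2) square_free_class_ck square_free_class_prefix append_assoc by metis
  qed
  have W: "square_free_class (row_reading_word P @ r @ w)" using Cons.prems(2) by simp
  have "square_free_class (row_reading_word P @ r @ w')"
    using W square_free_class_ck[OF ck_triple_equiv[OF Cons.prems(3), of "row_reading_word P @ r" "[]"]]
    by simp
  note sfs = sf[OF r(2) W] sf[OF r' this]
  have "foldl eg_insert P (snd (row_insert_word r w)) = foldl eg_insert P (snd (row_insert_word r w'))"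
    using row_insert_word_ck_triple(2)[OF r Cons.prems(3)] Cons.IH sfs Cons.prems(1)
    by (metis list.set_intros(2))
  then show ?case
    using row_insert_word_ck_triple(1)[OF r Cons.prems(3)] by (simp only: foldl_eg_insert_Cons)
qed

lemma eg_tableau_ck_step:
  assumes "ck_step u v" "square_free_class u"
  shows "eg_tableau u = eg_tableau v"
  using assms
proof (cases rule: ck_step.cases)
  case (1 u' v' p q)
  have p: "square_free_class p" "square_free_class (p @ u')"
    using assms(2) square_free_class_prefix[of p] square_free_class_prefix[of "p @ u'" q]
    unfolding 1 by auto
  have "row_reading_word (eg_tableau p) @ u' \<simeq> p @ u'"
    using eg_tableau_correct(2)[OF p(1)] by (intro ck_equiv_append) (auto intro: equivclp_sym)
  then have "square_free_class (row_reading_word (eg_tableau p) @ u')"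
    using p(2) square_free_class_ck equivclp_sym by metis
  from foldl_eg_insert_ck_triple[OF eg_tableau_correct(1)[OF p(1)] this 1(3)]
  show ?thesis by (simp add: 1 eg_tableau_def)
qed

lemma eg_tableau_ck_equiv:
  assumes "u \<simeq> v" "square_free_class u"
  shows "eg_tableau u = eg_tableau v"
  using assms
proof (induction rule: equivclp_induct)
  case (step v w)
  then have "square_free_class v" "square_free_class w"
    by (meson square_free_class_ck equivclp_into_equivclp)+
  with step show ?case using eg_tableau_ck_step by metis
qed simp

section \<open>Inserting the reading word of an increasing tableau\<close>

lemma row_insert_word_append:
  assumes "sorted_wrt (<) (B @ s)" shows "row_insert_word B s = (B @ s, [])"
  using assms
proof (induction s arbitrary: B)
  case (Cons x s)
  have "row_insert B x = (B @ [x], [])"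
    using Cons.prems by (intro row_insert_append) (auto simp: sorted_wrt_append)
  then show ?case using Cons.IH[of "B @ [x]"] Cons.prems by simp
qed simp

text \<open>Each letter of \<open>s\<close> bumps the letter above it in its column, so the lower
  row ejects the upper one intact. \<open>B\<close> collects the letters already inserted.\<close>

lemma row_insert_word_column_strict:
  assumes "sorted_wrt (<) (B @ t)" "sorted_wrt (<) (B @ s)" "length t \<le> length s"
    "\<forall>j<length t. s ! j < t ! j"
  shows "row_insert_word (B @ t) s = (B @ s, t)"
  using assms
proof (induction t arbitrary: B s)
  case Nil
  then show ?case using row_insert_word_append by simp
next
  case (Cons y t)
  obtain x s' where s: "s = x # s'" using Cons.prems(3) by (cases s) auto
  have xy: "x < y" using Cons.prems(4) s by force
  have "row_insert (B @ y # t) x = (B @ x # t, [y])"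
    using Cons.prems xy unfolding s by (intro row_insert_bump) (auto simp: sorted_wrt_append)
  moreover have "row_insert_word ((B @ [x]) @ t) s' = ((B @ [x]) @ s', t)"
  proof (rule Cons.IH)
    show "sorted_wrt (<) ((B @ [x]) @ t)"
      using Cons.prems xy unfolding s by (auto simp: sorted_wrt_append)
    show "\<forall>j<length t. s' ! j < t ! j" using Cons.prems(4) unfolding s by fastforce
  qed (use Cons.prems in \<open>auto simp: s\<close>)
  ultimately show ?case by (simp add: s)
qed

lemma increasing_young_tableau_tl:
  "increasing_young_tableau (r # P) \<Longrightarrow> increasing_young_tableau P"
  unfolding increasing_young_tableau_def by fastforce

text \<open>Reading words start with the top row. Each further row pushes the tableau built so far
  up by one level and takes its place at the bottom.\<close>

lemma foldl_eg_insert_tableau: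
  "increasing_young_tableau (r # P) \<Longrightarrow> foldl eg_insert P r = r # P"
proof (induction P arbitrary: r)
  case Nil
  then have r: "r \<noteq> []" "sorted_wrt (<) r" by (auto simp: increasing_young_tableau_def)
  then show ?case
    using row_insert_word_append[of "[]" r] by (simp add: foldl_eg_insert_Nil foldl_eg_insert_Cons)
next
  case (Cons r' P)
  have "row_insert_word ([] @ r') r = ([] @ r, r')"
    using Cons.prems unfolding increasing_young_tableau_def
    by (intro row_insert_word_column_strict) fastforce+
  then show ?case
    using Cons.IH[OF increasing_young_tableau_tl[OF Cons.prems]] by (simp add: foldl_eg_insert_Cons)
qed

text \<open>With the invariance under \<simeq>, a square-free class contains the reading word of at
  most one increasing tableau.\<close>

lemma eg_tableau_row_reading_word:
  "increasing_young_tableau T \<Longrightarrow> eg_tableau (row_reading_word T) = T"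
proof (induction T)
  case (Cons r P)
  then show ?case
    using foldl_eg_insert_tableau increasing_young_tableau_tl by (fastforce simp: eg_tableau_def)
qed (simp add: eg_tableau_def)

section \<open>Drop\<close>

fun matched_fst :: "(nat \<times> nat option) list \<Rightarrow> nat list" where
  "matched_fst [] = []"
| "matched_fst ((x, None) # al) = matched_fst al"
| "matched_fst ((x, Some y) # al) = x # matched_fst al"

fun matched_snd :: "(nat \<times> nat option) list \<Rightarrow> nat list" where
  "matched_snd [] = []"
| "matched_snd ((x, None) # al) = matched_snd al"
| "matched_snd ((x, Some y) # al) = y # matched_snd al"

text \<open>The lower row after a drop, read off the alignment from left to right.  The argument
  \<open>Some p\<close> says that the letter \<open>p\<close> has just been written and may start or
  continue a run of letters that are raised by one.\<close>

fun dropped_row :: "nat option \<Rightarrow> (nat \<times> nat option) list \<Rightarrow> nat list" where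
  "dropped_row p [] = []"
| "dropped_row p ((x, None) # al) = x # dropped_row (Some x) al"
| "dropped_row p ((x, Some y) # al) =
    (if p = Some y \<and> x = Suc y then x # dropped_row (Some x) al else y # dropped_row None al)"

lemma align_Nil [simp]: "snd (align P xs []) = []"
  by (induction xs) simp_all

lemma align_fst: "map fst (fst (align P xs ys)) = xs"
  by (induction P xs ys rule: align.induct) auto

lemma align_matched:
  "align P xs ys = (al, rest) \<Longrightarrow>
    matched_snd al @ rest = ys \<and> (\<forall>x y. (x, Some y) \<in> set al \<longrightarrow> P x y)"
proof (induction xs arbitrary: ys al rest)
  case (Cons x xs)
  show ?case
  proof (cases ys)
    case Nil
    obtain al' where "align P xs [] = (al', [])" by (metis align_Nil prod.collapse)
    then show ?thesis using Cons Nil by fastforce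
  next
    case (Cons y ys')
    show ?thesis
    proof (cases "P x y")
      case True
      obtain al' rest' where "align P xs ys' = (al', rest')" by fastforce
      then show ?thesis using Cons.prems Cons.IH[of ys'] Cons True by auto
    next
      case False
      obtain al' rest' where "align P xs (y # ys') = (al', rest')" by fastforce
      then show ?thesis using Cons.prems Cons.IH[of "y # ys'"] Cons False by auto
    qed
  qed
qed simp

lemma set_matched_fst: "set (matched_fst al) \<subseteq> fst ` set al"
  by (induction al rule: matched_fst.induct) auto

lemma sorted_matched_fst: "sorted_wrt (<) (map fst al) \<Longrightarrow> sorted_wrt (<) (matched_fst al)"
  using set_matched_fst by (induction al rule: matched_fst.induct) fastforce+

lemma length_matched_fst: "length (matched_fst al) \<le> length al"
  by (induction al rule: matched_fst.induct) auto

text \<open>If no letter was skipped, column \<open>j\<close> is matched with column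
  \<open>j\<close>. Used contrapositively: when the condition for a drop holds, some letter is
  unmatched and moves down.\<close>

lemma align_all_matched:
  assumes "align P xs ys = (al, rest)" "length (matched_fst al) = length xs"
  shows "length xs \<le> length ys \<and> (\<forall>j<length xs. P (xs ! j) (ys ! j))"
  using assms
proof (induction xs arbitrary: ys al)
  case (Cons x xs)
  obtain a al' where al: "al = a # al'" "fst a = x" "map fst al' = xs"
    using align_fst[of P "x # xs" ys] Cons.prems(1) by auto
  then have "length al' = length xs" by auto
  with Cons.prems(2) length_matched_fst[of al'] al obtain y where a: "a = (x, Some y)"
    by (cases a; cases "snd a") auto
  then have "matched_snd al @ rest = ys" "P x y"
    using align_matched[OF Cons.prems(1)] al by auto
  then obtain ys' where ys: "ys = y # ys'" using al a by auto
  then have "align P xs ys' = (al', rest)"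
    using Cons.prems(1) \<open>P x y\<close> al a by (cases "align P xs ys'") auto
  then show ?case using Cons.IH[of ys' al'] Cons.prems(2) al a ys \<open>P x y\<close>
    by (auto simp: nth_Cons split: nat.split)
qed simp

lemma Max_prefix_0 [simp]: "Max {b \<in> {..0::nat}. \<forall>i\<in>{1..b}. Q i} = 0"
proof -
  have "{b \<in> {..0::nat}. \<forall>i\<in>{1..b}. Q i} = {0}" by auto
  then show ?thesis by simp
qed

text \<open>Peels off one position of the maxima that define the numbers of raised and lowered
  letters, turning both into list recursions.\<close>

lemma Max_prefix_Suc:
  "Max {b \<in> {..Suc n}. \<forall>i\<in>{1..b}. Q i} =
    (if Q 1 then Suc (Max {b \<in> {..n}. \<forall>i\<in>{1..b}. Q (Suc i)}) else 0)"
proof (cases "Q 1")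
  case True
  let ?S = "{b \<in> {..n}. \<forall>i\<in>{1..b}. Q (Suc i)}"
  have "{b \<in> {..Suc n}. \<forall>i\<in>{1..b}. Q i} = insert 0 (Suc ` ?S)"
  proof (intro set_eqI)
    fix b
    show "b \<in> {b \<in> {..Suc n}. \<forall>i\<in>{1..b}. Q i} \<longleftrightarrow> b \<in> insert 0 (Suc ` ?S)"
    proof (cases b)
      case (Suc c)
      have "(\<forall>i\<in>{1..Suc c}. Q i) \<longleftrightarrow> (\<forall>i\<in>{1..c}. Q (Suc i))"
      proof
        assume *: "\<forall>i\<in>{1..c}. Q (Suc i)"
        show "\<forall>i\<in>{1..Suc c}. Q i"
        proof
          fix i assume "i \<in> {1..Suc c}"
          then show "Q i" using * True by (cases "i = 1"; cases i) auto
        qed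
      qed auto
      then show ?thesis using Suc by auto
    qed simp
  qed
  moreover have "Max (insert 0 (Suc ` ?S)) = Suc (Max ?S)"
  proof -
    have "finite ?S" "?S \<noteq> {}" by (auto intro!: exI[of _ 0])
    then show ?thesis by (simp add: mono_Max_commute[symmetric] mono_Suc)
  qed
  ultimately show ?thesis using True by simp
next
  case False
  then have "{b \<in> {..Suc n}. \<forall>i\<in>{1..b}. Q i} = {0}" by (force simp: Suc_le_eq)
  then show ?thesis using False by simp
qed

fun run_length :: "nat \<Rightarrow> nat list \<Rightarrow> nat" where
  "run_length c [] = 0"
| "run_length c (a # t) = (if a = Suc c then Suc (run_length (Suc c) t) else 0)"

lemma Max_run_length: "Max {b \<in> {..length t}. \<forall>i\<in>{1..b}. t ! (i - 1) = c + i} = run_length c t"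
proof (induction t arbitrary: c)
  case Nil
  show ?case using Max_prefix_0 by simp
next
  case (Cons a t)
  have shift: "(\<forall>i\<in>{1..b}. (a # t) ! (Suc i - 1) = c + Suc i) \<longleftrightarrow>
      (\<forall>i\<in>{1..b}. t ! (i - 1) = Suc c + i)" for b
    by (rule ball_cong) (auto simp: nth_Cons')
  show ?case unfolding length_Cons Max_prefix_Suc shift Cons by simp
qed

lemma drop_bound_eq:
  "drop_bound x t s = (if t \<noteq> [] \<and> x + 1 = t ! 0 then run_length (s ! 0) t else 0)"
  by (simp only: drop_bound_def Max_run_length)

lemma drop_hat_Nil [simp]: "drop_hat x [] [] = []"
  by (simp add: drop_hat_def drop_bound_eq)

text \<open>A positive bound requires \<open>x = Suc p\<close> and \<open>x = Suc y\<close>, hence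
  \<open>y = p\<close>. The two tests of the block formula thus amount to the single test in
  \<open>dropped_row\<close>.\<close>

lemma drop_hat_other:
  assumes "\<not> (y = p \<and> x = Suc y)"
  shows "drop_hat p (x # t) (y # s) = y # s"
  using assms by (auto simp: drop_hat_def drop_bound_eq)

text \<open>If the next upper letter is p + 2, the lower letter matched with it lies strictly
  between p and p + 2, hence is p + 1. So the raised \<open>Suc p\<close> acts as the new preceding
  letter, and raising can be decided column by column.\<close>

lemma drop_hat_chain:
  assumes "list_all2 (<) s t" "sorted_wrt (<) (p # s)"
  shows "drop_hat p (Suc p # t) (p # s) = Suc p # drop_hat (Suc p) t s"
proof -
  have "run_length (Suc p) t = drop_bound (Suc p) t s"
    using assms by (cases t; cases s) (auto simp: drop_bound_eq less_Suc_eq)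
  then show ?thesis by (simp add: drop_hat_def drop_bound_eq Let_def)
qed

text \<open>\<open>None\<close> serves the initial block, \<open>Some p\<close> a block behind the
  letter \<open>p\<close>. The latter is proved for all \<open>p\<close>, since raising a letter
  changes the preceding one.\<close>

lemma blocks_drop:
  assumes "\<forall>x y. (x, Some y) \<in> set al \<longrightarrow> y < x" "sorted_wrt (<) (matched_snd al)"
    "blocks al = ((u, v), bs)"
  shows "matched_fst al = u @ concat (map (\<lambda>(x, t, s). t) bs)"
    and "matched_snd al = v @ concat (map (\<lambda>(x, t, s). s) bs)"
    and "list_all2 (<) v u"
    and "dropped_row None al = v @ concat (map (\<lambda>(x, t, s). x # drop_hat x t s) bs)"
    and "dropped_row (Some p) al =
      drop_hat p u v @ concat (map (\<lambda>(x, t, s). x # drop_hat x t s) bs)"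
  using assms
proof (induction al arbitrary: u v bs p rule: blocks.induct)
  case 1
  { case 1 then show ?case by simp }
  { case 2 then show ?case by simp }
  { case 3 then show ?case by simp }
  { case 4 then show ?case by simp }
  { case 5 then show ?case by simp }
next
  case (2 x y al)
  obtain u' v' bs' where b: "blocks al = ((u', v'), bs')" by (metis prod.collapse)
  { case 1 then show ?case using 2 b by auto }
  { case 2 then show ?case using "2.IH" b by auto }
  { case 3 then show ?case using "2.IH" b by auto }
  { case 4 then show ?case using "2.IH" b by auto }
  { case 5
    have IH: "matched_snd al = v' @ concat (map (\<lambda>(x, t, s). s) bs')" "list_all2 (<) v' u'"
      "\<And>p. dropped_row (Some p) al = drop_hat p u' v' @ concat (map (\<lambda>(x, t, s). x # drop_hat x t s) bs')"
      "dropped_row None al = v' @ concat (map (\<lambda>(x, t, s). x # drop_hat x t s) bs')"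
      using "2.IH" b 5 by auto
    have "sorted_wrt (<) (y # v')" using 5 IH(1) by (auto simp: sorted_wrt_append)
    then show ?case using 5 b IH drop_hat_chain[OF IH(2), of y] drop_hat_other[of y p x u' v']
      by auto }
next
  case (3 x al)
  obtain u' v' bs' where b: "blocks al = ((u', v'), bs')" by (metis prod.collapse)
  { case 1 then show ?case using "3.IH" b by auto }
  { case 2 then show ?case using "3.IH" b by auto }
  { case 3 then show ?case using "3.IH" b by auto }
  { case 4 then show ?case using "3.IH" b by auto }
  { case 5 then show ?case using "3.IH" b by auto }
qed

lemma drop_pair_eq:
  assumes "sorted_wrt (<) \<sigma>" "align (>) \<tau> \<sigma> = (al, rest)"
  shows "drop_pair \<tau> \<sigma> = (matched_fst al, dropped_row None al @ rest)"
proof -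
  obtain u v bs where b: "blocks al = ((u, v), bs)" by (metis prod.collapse)
  from align_matched[OF assms(2)] have "matched_snd al @ rest = \<sigma>"
    "\<forall>x y. (x, Some y) \<in> set al \<longrightarrow> y < x" by auto
  then show ?thesis
    using blocks_drop(1,4)[OF _ _ b] assms by (auto simp: drop_pair_def b sorted_wrt_append)
qed

text \<open>Aligning from left to right performs the row insertion of the letters of \<open>s\<close> into the
  row \<open>B @ t\<close>: each of them bumps the letter of \<open>t\<close> it is matched with, and
  the special case of Edelman--Greene bumping is the raising of a letter.\<close>

lemma drop_align_correct:
  assumes "align (>) t s = (al, rest)" "sorted_wrt (<) (B @ t)" "sorted_wrt (<) s"
    "square_free_class (B @ t @ s)" "\<forall>b\<in>set B. \<forall>y\<in>set s. b \<le> y"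
    "case p of None \<Rightarrow> \<forall>b\<in>set B. \<forall>y\<in>set s. b < y | Some q \<Rightarrow> \<exists>B'. B = B' @ [q]"
  shows "B @ t @ s \<simeq> matched_fst al @ B @ dropped_row p al @ rest \<and>
    sorted_wrt (<) (B @ dropped_row p al @ rest)"
  using assms
proof (induction t arbitrary: B p s al)
  case Nil
  \<comment> \<open>Equality could occur only between the last letter of \<open>B\<close> and the
    first of \<open>s\<close>; these are now adjacent and would form a square.\<close>
  have "\<forall>b\<in>set B. \<forall>y\<in>set s. b < y"
  proof (cases p)
    case (Some q)
    then obtain B' where B: "B = B' @ [q]" using Nil by auto
    show ?thesis
    proof (cases s)
      case (Cons y s')
      have "q \<noteq> y" using Nil.prems(4) square_free_class_no_square[of B' q s'] B Cons by auto
      then have "q < y" using Nil.prems(5) B Cons by simp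
      moreover have "\<forall>b\<in>set B. b \<le> q" "\<forall>z\<in>set s. y \<le> z"
        using Nil.prems(2,3) B Cons by (auto simp: sorted_wrt_append)
      ultimately show ?thesis by (metis le_less_trans less_le_trans)
    qed simp
  qed (use Nil in simp)
  then show ?case using Nil by (auto simp: sorted_wrt_append)
next
  case (Cons x t)
  let ?goal = ?case
  \<comment> \<open>An unmatched letter passes from \<open>t\<close> to \<open>B\<close>, so the
    word itself does not change.\<close>
  have step_None: ?goal
    if al: "al = (x, None) # al'" "align (>) t s = (al', rest)" and le: "\<forall>y\<in>set s. x \<le> y" for al'
    using Cons.IH[OF al(2), of "B @ [x]" "Some x"] Cons.prems le
    by (auto simp: al(1))
  show ?case
  proof (cases s)
    case Nil
    obtain al' where "align (>) t [] = (al', [])" by (metis align_Nil prod.collapse)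
    then show ?thesis using Nil Cons.prems by (intro step_None[of al']) auto
  next
    case s: (Cons y s')
    show ?thesis
    proof (cases "y < x")
      case False
      obtain al' rest' where "align (>) t s = (al', rest')" by fastforce
      then show ?thesis using False s Cons.prems by (intro step_None[of al']) auto
    next
      case True
      obtain al' where al: "align (>) t s' = (al', rest)" "al = (x, Some y) # al'"
        using Cons.prems(1) s True by (cases "align (>) t s'") auto
      have step: ?goal
        if eq: "(B @ x # t) @ [y] \<simeq> x # (B @ [z]) @ t"
          and z: "dropped_row p al = z # dropped_row p' al'" "sorted_wrt (<) ((B @ [z]) @ t)"
            "\<forall>b\<in>set (B @ [z]). \<forall>y\<in>set s'. b \<le> y"
            "case p' of None \<Rightarrow> \<forall>b\<in>set (B @ [z]). \<forall>y\<in>set s'. b < y | Some q \<Rightarrow> \<exists>B'. B @ [z] = B' @ [q]"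
          for z p'
      proof -
        from ck_equiv_append[OF eq equivclp_refl, of s']
        have eq': "B @ (x # t) @ s \<simeq> x # (B @ [z]) @ t @ s'" by (simp add: s)
        from square_free_class_ck[OF eq' Cons.prems(4)]
        have "square_free_class ((B @ [z]) @ t @ s')"
          using square_free_class_suffix[of "[x]"] by simp
        from Cons.IH[OF al(1) z(2) _ this z(3,4)] Cons.prems(3)
        have IH: "(B @ [z]) @ t @ s' \<simeq> matched_fst al' @ (B @ [z]) @ dropped_row p' al' @ rest"
          "sorted_wrt (<) ((B @ [z]) @ dropped_row p' al' @ rest)" by (auto simp: s)
        from equivclp_trans[OF eq' ck_equiv_Cons[OF IH(1)]] IH(2) z(1)
        show ?thesis by (simp add: al)
      qed
      show ?thesis
      proof (cases "p = Some y")
        case p: True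
        then obtain B' where B: "B = B' @ [y]" using Cons.prems by auto
        \<comment> \<open>The incoming \<open>y\<close> already ends \<open>B\<close>, so
          square-freeness forces \<open>Suc y\<close> into the row, and it can only be the next
          letter \<open>x\<close>.\<close>
        have "Suc y \<in> set (B @ x # t)"
          using Suc_mem_row[of "B @ x # t" y] Cons.prems(2,4) B s
            square_free_class_prefix[of "B @ x # t @ [y]" s'] by auto
        then have x: "x = Suc y"
          using True Cons.prems(2) B by (auto simp: sorted_wrt_append)
        show ?thesis
        proof (rule step[of x "Some x"])
          show "(B @ x # t) @ [y] \<simeq> x # (B @ [x]) @ t"
            using ck_equiv_bump_Suc[of B' y t] Cons.prems(2) B x by simp
          show "\<forall>b\<in>set (B @ [x]). \<forall>y\<in>set s'. b \<le> y"
            using Cons.prems(3,5) s x by auto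
        qed (use Cons.prems p x al in auto)
      next
        case p: False
        have B: "\<forall>b\<in>set B. b < y"
        proof (cases p)
          case (Some q)
          then obtain B' where "B = B' @ [q]" using Cons.prems by auto
          moreover from this have "q < y" using Some p Cons.prems(5) s by simp
          ultimately show ?thesis using Cons.prems(2) by (auto simp: sorted_wrt_append)
        qed (use Cons.prems s in simp)
        show ?thesis
        proof (rule step[of y None])
          show "(B @ x # t) @ [y] \<simeq> x # (B @ [y]) @ t"
            using ck_equiv_bump[of B x t y] Cons.prems(2) B True by simp
          show "sorted_wrt (<) ((B @ [y]) @ t)"
            using Cons.prems(2) B True by (auto simp: sorted_wrt_append)
        qed (use Cons.prems(3,5) B p al s in \<open>auto intro: less_imp_le less_trans\<close>)
      qed
    qed
  qed
qed

lemma drop_pair_correct: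
  assumes "sorted_wrt (<) \<tau>" "sorted_wrt (<) \<sigma>" "square_free_class (\<tau> @ \<sigma>)"
    "drop_pair \<tau> \<sigma> = (\<tau>', \<sigma>')"
  shows "\<tau> @ \<sigma> \<simeq> \<tau>' @ \<sigma>'" "sorted_wrt (<) \<tau>'" "sorted_wrt (<) \<sigma>'"
proof -
  obtain al rest where al: "align (>) \<tau> \<sigma> = (al, rest)" by fastforce
  have eq: "\<tau>' = matched_fst al" "\<sigma>' = dropped_row None al @ rest"
    using drop_pair_eq[OF assms(2) al] assms(4) by auto
  from drop_align_correct[OF al, of "[]" None] assms
  show "\<tau> @ \<sigma> \<simeq> \<tau>' @ \<sigma>'" "sorted_wrt (<) \<sigma>'" by (auto simp: eq)
  show "sorted_wrt (<) \<tau>'" unfolding eq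
    using sorted_matched_fst align_fst[of "(>)" \<tau> \<sigma>] al assms(1) by simp
qed

lemma drop_pair_length_less:
  assumes "sorted_wrt (<) \<sigma>" "drop_pair \<tau> \<sigma> = (\<tau>', \<sigma>')"
    "length \<tau> > length \<sigma> \<or> (\<exists>j<min (length \<sigma>) (length \<tau>). \<tau> ! j \<le> \<sigma> ! j)"
  shows "length \<tau>' < length \<tau>"
proof -
  obtain al rest where al: "align (>) \<tau> \<sigma> = (al, rest)" by fastforce
  have "\<tau>' = matched_fst al" using drop_pair_eq[OF assms(1) al] assms(2) by simp
  moreover have "length al = length \<tau>" using align_fst[of "(>)" \<tau> \<sigma>] al by auto
  moreover have "length (matched_fst al) \<noteq> length \<tau>"
    using align_all_matched[OF al] assms(3) by (metis leD min_less_iff_conj)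
  ultimately show ?thesis using length_matched_fst[of al] by simp
qed

section \<open>Arrays of rows and termination of the drops\<close>

lemma row_reading_word_append [simp]:
  "row_reading_word (A @ B) = row_reading_word B @ row_reading_word A"
  by (simp add: row_reading_word_def)

lemma split_rows:
  assumes "Suc k < length R"
  shows "R = take k R @ [R ! k, R ! Suc k] @ drop (Suc (Suc k)) R"
    and "R[k := \<sigma>, Suc k := \<tau>] = take k R @ [\<sigma>, \<tau>] @ drop (Suc (Suc k)) R"
proof -
  show 1: "R = take k R @ [R ! k, R ! Suc k] @ drop (Suc (Suc k)) R"
    using assms by (simp add: Cons_nth_drop_Suc)
  show "R[k := \<sigma>, Suc k := \<tau>] = take k R @ [\<sigma>, \<tau>] @ drop (Suc (Suc k)) R"
    using assms by (subst 1) (simp add: list_update_append min_def)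
qed

lemma row_reading_word_update:
  assumes "Suc k < length R" "R ! Suc k @ R ! k \<simeq> \<tau> @ \<sigma>"
  shows "row_reading_word R \<simeq> row_reading_word (R[k := \<sigma>, Suc k := \<tau>])"
proof -
  have "row_reading_word R =
      row_reading_word (drop (Suc (Suc k)) R) @ (R ! Suc k @ R ! k) @ row_reading_word (take k R)"
    using arg_cong[OF split_rows(1)[OF assms(1)], of row_reading_word] by simp
  moreover have "row_reading_word (R[k := \<sigma>, Suc k := \<tau>]) =
      row_reading_word (drop (Suc (Suc k)) R) @ (\<tau> @ \<sigma>) @ row_reading_word (take k R)"
    unfolding split_rows(2)[OF assms(1)] by simp
  ultimately show ?thesis using ck_equiv_context[OF assms(2)] by metis
qed

lemma square_free_class_rows:
  assumes "Suc k < length R" "square_free_class (row_reading_word R)"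
  shows "square_free_class (R ! Suc k @ R ! k)"
proof -
  have "row_reading_word R =
      row_reading_word (drop (Suc (Suc k)) R) @ (R ! Suc k @ R ! k) @ row_reading_word (take k R)"
    using arg_cong[OF split_rows(1)[OF assms(1)], of row_reading_word] by simp
  then show ?thesis using assms(2) square_free_class_factor by metis
qed

lemma increasing_rows_update:
  assumes "increasing_rows R" "sorted_wrt (<) \<sigma>" "sorted_wrt (<) \<tau>"
  shows "increasing_rows (R[k := \<sigma>, Suc k := \<tau>])"
  using assms set_update_subset_insert[of "R[k := \<sigma>]" "Suc k" \<tau>]
    set_update_subset_insert[of R k \<sigma>] by blast

text \<open>The sum over all letters of the zero-based index of their row. Drops that move a letter
  decrease it, lifts that change the array increase it.\<close>

fun total_height :: "nat list list \<Rightarrow> nat" where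
  "total_height [] = 0"
| "total_height (r # P) = length (concat P) + total_height P"

lemma total_height_update_less:
  assumes "Suc k < length R" "length \<sigma> + length \<tau> = length (R ! k) + length (R ! Suc k)"
    "length \<tau> < length (R ! Suc k)"
  shows "total_height (R[k := \<sigma>, Suc k := \<tau>]) < total_height R \<and>
    length (concat (R[k := \<sigma>, Suc k := \<tau>])) = length (concat R)"
  using assms
proof (induction R arbitrary: k)
  case (Cons r P)
  show ?case
  proof (cases k)
    case 0
    obtain r' P' where "P = r' # P'" using Cons.prems(1) by (cases P) auto
    then show ?thesis using 0 Cons.prems by simp
  next
    case (Suc j)
    then show ?thesis using Cons.IH[of j] Cons.prems by simp
  qed
qed simp

lemma total_height_le: "total_height R \<le> length R * length (concat R)"
proof (induction R)
  case (Cons r P)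
  have "length P * length (concat P) \<le> length P * length (concat (r # P))" by simp
  with Cons show ?case by (simp add: distrib_left)
qed simp

lemma ck_equiv_length: "u \<simeq> v \<Longrightarrow> length u = length v"
  using ck_equiv_braid_equiv braid_equiv_word_perm by blast

lemma drop_at_correct:
  assumes k: "Suc k < length R" and R: "increasing_rows R" "square_free_class (row_reading_word R)"
  shows "increasing_rows (drop_at k R)" "row_reading_word R \<simeq> row_reading_word (drop_at k R)"
    and "length (R ! Suc k) > length (R ! k) \<or>
        (\<exists>j<min (length (R ! k)) (length (R ! Suc k)). R ! Suc k ! j \<le> R ! k ! j) \<Longrightarrow>
      total_height (drop_at k R) < total_height R"
proof -
  obtain \<tau> \<sigma> where p: "drop_pair (R ! Suc k) (R ! k) = (\<tau>, \<sigma>)" by fastforce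
  have rows: "sorted_wrt (<) (R ! k)" "sorted_wrt (<) (R ! Suc k)" using R(1) k by auto
  note correct = drop_pair_correct[OF rows(2,1) square_free_class_rows[OF k R(2)] p]
  have eq: "drop_at k R = R[k := \<sigma>, Suc k := \<tau>]" by (simp add: drop_at_def p)
  show "increasing_rows (drop_at k R)"
    unfolding eq using increasing_rows_update R(1) correct(2,3) by blast
  show "row_reading_word R \<simeq> row_reading_word (drop_at k R)"
    unfolding eq using row_reading_word_update[OF k correct(1)] .
  assume "length (R ! Suc k) > length (R ! k) \<or>
        (\<exists>j<min (length (R ! k)) (length (R ! Suc k)). R ! Suc k ! j \<le> R ! k ! j)"
  then have "length \<tau> < length (R ! Suc k)" using drop_pair_length_less[OF rows(1) p] by simp
  then show "total_height (drop_at k R) < total_height R"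
    unfolding eq using total_height_update_less[OF k] ck_equiv_length[OF correct(1)] by simp
qed

lemma increasing_young_tableau_Cons:
  assumes "r \<noteq> []" "sorted_wrt (<) r" "increasing_young_tableau P"
    "P \<noteq> [] \<Longrightarrow> length (hd P) \<le> length r \<and> (\<forall>j<length (hd P). r ! j < hd P ! j)"
  shows "increasing_young_tableau (r # P)"
  unfolding increasing_young_tableau_def
proof (intro conjI allI impI)
  show "\<forall>q\<in>set (r # P). q \<noteq> [] \<and> sorted_wrt (<) q"
    using assms by (auto simp: increasing_young_tableau_def)
  fix k assume k: "Suc k < length (r # P)"
  have "length ((r # P) ! Suc k) \<le> length ((r # P) ! k) \<and>
      (\<forall>j<length ((r # P) ! Suc k). (r # P) ! k ! j < (r # P) ! Suc k ! j)"
  proof (cases k)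
    case 0
    then show ?thesis using assms(4) k by (cases P) auto
  next
    case (Suc i)
    then show ?thesis using assms(3) k by (auto simp: increasing_young_tableau_def)
  qed
  then show "length ((r # P) ! Suc k) \<le> length ((r # P) ! k)"
    "\<And>j. j < length ((r # P) ! Suc k) \<Longrightarrow> (r # P) ! k ! j < (r # P) ! Suc k ! j" by auto
qed

text \<open>When no drop is available the row lengths weakly decrease upward, so all empty rows lie
  on top and deleting them creates no new neighbours. The second conjunct carries this through the
  induction.\<close>

lemma increasing_young_tableau_nonempty_rows:
  assumes "increasing_rows R"
    and "\<And>k. Suc k < length R \<Longrightarrow> length (R ! Suc k) \<le> length (R ! k) \<and>
      (\<forall>j<min (length (R ! k)) (length (R ! Suc k)). R ! k ! j < R ! Suc k ! j)"
  shows "increasing_young_tableau (nonempty_rows R) \<and> (R \<noteq> [] \<and> hd R = [] \<longrightarrow> nonempty_rows R = [])"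
  using assms
proof (induction R)
  case Nil
  then show ?case by (simp add: increasing_young_tableau_def)
next
  case (Cons r P)
  have P: "length (P ! Suc k) \<le> length (P ! k) \<and>
      (\<forall>j<min (length (P ! k)) (length (P ! Suc k)). P ! k ! j < P ! Suc k ! j)"
    if "Suc k < length P" for k using Cons.prems(2)[of "Suc k"] that by simp
  have IH: "increasing_young_tableau (nonempty_rows P)"
    "P \<noteq> [] \<Longrightarrow> hd P = [] \<Longrightarrow> nonempty_rows P = []"
    using Cons.IH[OF _ P] Cons.prems(1) by auto
  have hd: "P \<noteq> [] \<Longrightarrow> length (hd P) \<le> length r \<and>
      (\<forall>j<min (length r) (length (hd P)). r ! j < hd P ! j)"
    using Cons.prems(2)[of 0] by (cases P) auto
  show ?case
  proof (cases "r = []")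
    case True
    then have "nonempty_rows P = []" using hd IH(2) by (cases P) auto
    then show ?thesis using True IH(1) by simp
  next
    case False
    have "increasing_young_tableau (r # nonempty_rows P)"
    proof (rule increasing_young_tableau_Cons[OF False _ IH(1)])
      assume "nonempty_rows P \<noteq> []"
      then have "P \<noteq> []" by auto
      with \<open>nonempty_rows P \<noteq> []\<close> have "hd P \<noteq> []" using IH(2) by auto
      with \<open>P \<noteq> []\<close> have "hd (nonempty_rows P) = hd P" by (cases P) auto
      then show "length (hd (nonempty_rows P)) \<le> length r \<and>
          (\<forall>j<length (hd (nonempty_rows P)). r ! j < hd (nonempty_rows P) ! j)"
        using hd[OF \<open>P \<noteq> []\<close>] by auto
    qed (use Cons.prems in simp)
    then show ?thesis using False by simp
  qed
qed

lemma row_reading_word_nonempty_rows [simp]: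
  "row_reading_word (nonempty_rows R) = row_reading_word R"
  by (induction R) auto

lemma drop_step_correct:
  assumes "drop_step R R'" "increasing_rows R" "square_free_class (row_reading_word R)"
  shows "increasing_rows R'" "row_reading_word R \<simeq> row_reading_word R'"
    "total_height R' < total_height R"
  using assms drop_at_correct unfolding drop_step_def by blast+

lemma drop_steps_correct:
  assumes "drop_step\<^sup>*\<^sup>* R R'" "increasing_rows R" "square_free_class (row_reading_word R)"
  shows "increasing_rows R' \<and> row_reading_word R \<simeq> row_reading_word R'"
  using assms
proof (induction rule: rtranclp_induct)
  case (step R' R'')
  then show ?case
    using drop_step_correct(1,2)[OF step(2)] square_free_class_ck by (blast intro: equivclp_trans)
qed simp

lemma drop_steps_exist:
  assumes "increasing_rows R" "square_free_class (row_reading_word R)"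
  shows "\<exists>R'. drop_step\<^sup>*\<^sup>* R R' \<and> increasing_young_tableau (nonempty_rows R')"
  using assms
proof (induction "total_height R" arbitrary: R rule: less_induct)
  case less
  show ?case
  proof (cases "increasing_young_tableau (nonempty_rows R)")
    case False
    then obtain k where "Suc k < length R" "\<not> (length (R ! Suc k) \<le> length (R ! k) \<and>
        (\<forall>j<min (length (R ! k)) (length (R ! Suc k)). R ! k ! j < R ! Suc k ! j))"
      using increasing_young_tableau_nonempty_rows[OF less(2)] by blast
    then have step: "drop_step R (drop_at k R)"
      using False unfolding drop_step_def not_le not_less by (metis not_le)
    note correct = drop_step_correct[OF step less(2,3)]
    have "\<exists>R'. drop_step\<^sup>*\<^sup>* (drop_at k R) R' \<and> increasing_young_tableau (nonempty_rows R')"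
      by (rule less(1)[OF correct(3,1) square_free_class_ck[OF correct(2) less(3)]])
    then show ?thesis using step by (meson converse_rtranclp_into_rtranclp)
  qed blast
qed

lemma runs_Cons: "\<exists>r R. runs (x # w) = (x # r) # R"
  by (cases w) auto

lemma concat_runs: "concat (runs w) = w"
proof (induction w rule: runs.induct)
  case (3 x y w)
  then show ?case using runs_Cons[of y w] by auto
qed auto

lemma increasing_runs: "increasing_rows (runs w)"
proof (induction w rule: runs.induct)
  case (3 x y w)
  obtain r R where "runs (y # w) = (y # r) # R" using runs_Cons by blast
  then show ?case using 3 by (auto intro: less_trans)
qed auto

text \<open>Some sequence of drops reaches an increasing tableau, and every tableau reached lies in
  the class of \<open>w\<close>, hence is the Edelman--Greene tableau. This justifies the definite
  description.\<close>

lemma drop_word_eq: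
  assumes "square_free_class w"
  shows "drop_word w = eg_tableau w"
proof -
  have w: "row_reading_word (run_rows w) = w" "increasing_rows (run_rows w)"
    using increasing_runs by (auto simp: row_reading_word_def run_rows_def concat_runs)
  have unique: "nonempty_rows R = eg_tableau w"
    if "drop_step\<^sup>*\<^sup>* (run_rows w) R" "increasing_young_tableau (nonempty_rows R)" for R
  proof -
    have "w \<simeq> row_reading_word R" using drop_steps_correct[OF that(1)] w assms by simp
    then have "eg_tableau w = eg_tableau (row_reading_word (nonempty_rows R))"
      using eg_tableau_ck_equiv assms by simp
    then show ?thesis using eg_tableau_row_reading_word[OF that(2)] by simp
  qed
  obtain R where "drop_step\<^sup>*\<^sup>* (run_rows w) R" "increasing_young_tableau (nonempty_rows R)"
    using drop_steps_exist[of "run_rows w"] w assms by auto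
  then show ?thesis unfolding drop_word_def using unique
    by (intro the_equality) metis+
qed

section \<open>Lift\<close>

text \<open>The rows after a lift are computed from the matched columns to the right of the current
  position.  In \<open>lowered_row a al\<close> the letters at the start of \<open>al\<close> that
  continue a column \<open>a\<close> over \<open>a\<close>, \<open>a + 1\<close> over \<open>a + 1\<close>, \<dots>
  are decreased by one.\<close>

fun lifted_top :: "(nat \<times> nat option) list \<Rightarrow> nat list" where
  "lifted_top [] = []"
| "lifted_top ((x, None) # al) = x # lifted_top al"
| "lifted_top ((x, Some y) # al) = y # lifted_top al"

fun lifted_row :: "(nat \<times> nat option) list \<Rightarrow> nat list"
  and lowered_row :: "nat \<Rightarrow> (nat \<times> nat option) list \<Rightarrow> nat list" where
  "lifted_row [] = []"
| "lifted_row ((x, None) # al) = lowered_row (Suc x) al"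
| "lifted_row ((x, Some y) # al) = x # lifted_row al"
| "lowered_row a [] = []"
| "lowered_row a ((x, None) # al) = lowered_row (Suc x) al"
| "lowered_row a ((x, Some y) # al) =
    (if x = a \<and> y = a then (a - 1) # lowered_row (Suc a) al else x # lifted_row al)"

fun common_run_length :: "nat \<Rightarrow> nat list \<Rightarrow> nat list \<Rightarrow> nat" where
  "common_run_length c (a # s) (b # t) =
    (if a = Suc c \<and> b = Suc c then Suc (common_run_length (Suc c) s t) else 0)"
| "common_run_length c _ _ = 0"

lemma Max_common_run_length:
  "length s = length t \<Longrightarrow>
    Max {b \<in> {..length s}. \<forall>i\<in>{1..b}. t ! (i - 1) = c + i \<and> s ! (i - 1) = c + i} =
      common_run_length c s t"
proof (induction c s t rule: common_run_length.induct)
  case (1 c a s b t)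
  have shift: "(\<forall>i\<in>{1..n}. (b # t) ! (Suc i - 1) = c + Suc i \<and> (a # s) ! (Suc i - 1) = c + Suc i) \<longleftrightarrow>
      (\<forall>i\<in>{1..n}. t ! (i - 1) = Suc c + i \<and> s ! (i - 1) = Suc c + i)" for n
    by (rule ball_cong) (auto simp: nth_Cons')
  show ?case using 1 unfolding length_Cons Max_prefix_Suc shift by auto
next
  case ("2_1" c t)
  then show ?case using Max_prefix_0 by simp
next
  case ("2_2" c s)
  then show ?case using Max_prefix_0 by simp
qed

lemma lift_bound_eq:
  assumes "length s = length t"
  shows "lift_bound x s t = common_run_length x s t"
proof -
  have "common_run_length x s t = 0" if "\<not> (s \<noteq> [] \<and> x + 1 = s ! 0)"
    using that by (cases s; cases t) auto
  then show ?thesis using Max_common_run_length[OF assms] by (simp only: lift_bound_def if_split) auto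
qed

lemma blocks_lift:
  assumes "blocks al = ((u, v), bs)"
  shows "length u = length v"
    and "lifted_top al = v @ concat (map (\<lambda>(x, s, t). x # t) bs)"
    and "lifted_row al = u @ concat (map (\<lambda>(x, s, t). lift_check x s t) bs)"
    and "lowered_row (Suc p) al =
      lift_check p u v @ concat (map (\<lambda>(x, s, t). lift_check x s t) bs)"
  using assms
proof (induction al arbitrary: u v bs p rule: blocks.induct)
  case 1
  { case 1 then show ?case by simp }
  { case 2 then show ?case by simp }
  { case 3 then show ?case by simp }
  { case 4 then show ?case by (simp add: lift_check_def lift_bound_eq) }
next
  case (2 x y al)
  obtain u' v' bs' where b: "blocks al = ((u', v'), bs')" by (metis prod.collapse)
  { case 1 then show ?case using "2.IH" b by auto }
  { case 2 then show ?case using "2.IH" b by auto }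
  { case 3 then show ?case using "2.IH" b by auto }
  { case 4 then show ?case using "2.IH" b by (auto simp: lift_check_def lift_bound_eq Let_def) }
next
  case (3 x al)
  obtain u' v' bs' where b: "blocks al = ((u', v'), bs')" by (metis prod.collapse)
  { case 1 then show ?case using "3.IH" b by auto }
  { case 2 then show ?case using "3.IH" b by auto }
  { case 3 then show ?case using "3.IH" b by auto }
  { case 4 then show ?case using "3.IH" b by (auto simp: lift_check_def lift_bound_eq) }
qed

lemma lift_pair_eq:
  assumes "align (\<le>) (rev \<sigma>) (rev \<tau>) = (al, rest)"
  shows "lift_pair \<tau> \<sigma> = (rev rest @ lifted_top (rev al), lifted_row (rev al))"
proof -
  obtain u v bs where b: "blocks (rev al) = ((u, v), bs)" by (metis prod.collapse)
  then show ?thesis using blocks_lift(2,3)[OF b] assms by (simp add: lift_pair_def)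
qed

text \<open>Lowering can only start at a column with equal letters. In the free state the lower part
  may therefore be read with any parameter, as the passage to a pending column requires.\<close>

lemma lowered_row_free:
  "(\<And>x al'. al \<noteq> (x, Some x) # al') \<Longrightarrow> lowered_row a al = lifted_row al"
  by (cases "(a, al)" rule: lowered_row.cases) auto

text \<open>\<open>lift_state ys xs al w\<close>: after the columns \<open>al\<close> have been formed, with the reversed upper
  and lower rows \<open>ys\<close> and \<open>xs\<close> still to be aligned, \<open>w\<close> is a word in the class.  While the
  leftmost column is \<open>a\<close> over \<open>a\<close>, the upper \<open>a\<close> is still to be inserted; this is possible
  only when \<open>a - 1\<close> arrives in the lower row, and it does arrive since \<open>w\<close> would
  otherwise be equivalent to a word containing \<open>a a\<close>.\<close>

inductive lift_state ::
  "nat list \<Rightarrow> nat list \<Rightarrow> (nat \<times> nat option) list \<Rightarrow> nat list \<Rightarrow> bool" where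
  free: "(\<And>x al'. al \<noteq> (x, Some x) # al') \<Longrightarrow>
    sorted_wrt (<) (rev ys @ lifted_top al) \<Longrightarrow> sorted_wrt (<) (rev xs @ lifted_top al) \<Longrightarrow>
    sorted_wrt (<) (rev xs @ lifted_row al) \<Longrightarrow>
    lift_state ys xs al (rev ys @ rev xs @ lifted_top al @ lifted_row al)"
| pending: "sorted_wrt (<) (rev ys @ a # lifted_top al) \<Longrightarrow>
    sorted_wrt (<) (rev xs @ a # lifted_top al) \<Longrightarrow>
    sorted_wrt (<) (lowered_row (Suc a) al) \<Longrightarrow> \<forall>z\<in>set (lowered_row (Suc a) al). a \<le> z \<Longrightarrow>
    lift_state ys xs ((a, Some a) # al)
      (rev ys @ a # rev xs @ a # lifted_top al @ lowered_row (Suc a) al)"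

text \<open>An instance of \<open>last_pred_row\<close>: the untreated lower letters are below
  \<open>a\<close> and separate its two copies.\<close>

lemma lift_state_pending_letter:
  assumes "square_free_class (rev ys @ a # rev xs @ a # C)" "sorted_wrt (<) (rev xs @ a # C')"
  shows "\<exists>s xs'. xs = s # xs' \<and> a = Suc s"
proof -
  have "square_free_class (a # rev xs @ a # C)" using assms(1) square_free_class_suffix by blast
  then obtain S b where "rev xs = S @ [b]" "a = Suc b"
    using last_pred_row[of "rev xs" a C] assms(2) by (auto simp: sorted_wrt_append)
  then show ?thesis by (metis rev_eq_append_conv rev.simps(2) append_Cons append_Nil rev_rev_ident)
qed

text \<open>Without a pending column \<open>s\<close> merely becomes part of the new top and the
  word stays the same. With one, \<open>s\<close> is the awaited \<open>a - 1\<close>: the pending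
  \<open>a\<close> enters the row and ejects \<open>s\<close>, which is the lowered letter.\<close>

lemma lift_state_unmatched:
  assumes "lift_state ys (s # xs) al w" "square_free_class w" "\<forall>y\<in>set ys. y < s"
  shows "\<exists>w'. lift_state ys xs ((s, None) # al) w' \<and> w \<simeq> w'"
  using assms(1)
proof (cases rule: lift_state.cases)
  case free
  have "lift_state ys xs ((s, None) # al)
      (rev ys @ rev xs @ lifted_top ((s, None) # al) @ lifted_row ((s, None) # al))"
    using free assms(3) by (intro lift_state.free)
      (auto simp: sorted_wrt_append lowered_row_free)
  then show ?thesis using free lowered_row_free[OF free(2)] by (intro exI conjI) auto
next
  case (pending a al')
  let ?L = "lowered_row (Suc a) al'"
  have a: "a = Suc s"
    using lift_state_pending_letter[of ys a "s # xs"] assms(2) pending by fastforce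
  have "lift_state ys xs ((s, None) # al)
      (rev ys @ rev xs @ lifted_top ((s, None) # al) @ lifted_row ((s, None) # al))"
    using pending assms(3) a by (intro lift_state.free) (auto simp: sorted_wrt_append Suc_le_eq intro: less_trans)
  moreover have "rev ys @ (Suc s # rev xs @ s # Suc s # lifted_top al') @ ?L \<simeq>
      rev ys @ (rev xs @ s # Suc s # lifted_top al' @ [s]) @ ?L"
    using pending(4) a by (intro ck_equiv_context ck_equiv_left_bump_Suc) simp
  ultimately show ?thesis using pending a by (intro exI conjI) auto
qed

text \<open>If \<open>s < t\<close>, the letter \<open>t\<close> enters and ejects \<open>s\<close>.
  If \<open>s = t\<close>, the column becomes pending. If \<open>a\<close> is already pending, then
  \<open>a = Suc s\<close>, and s \<le> t < a forces \<open>t = s\<close>: the old column is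
  resolved and the new one takes its place.\<close>

lemma lift_state_matched:
  assumes "lift_state (t # ys) (s # xs) al w" "square_free_class w" "s \<le> t"
  shows "\<exists>w'. lift_state ys xs ((s, Some t) # al) w' \<and> w \<simeq> w'"
  using assms(1)
proof (cases rule: lift_state.cases)
  case free
  show ?thesis
  proof (cases "s = t")
    case True
    have "lift_state ys xs ((s, Some s) # al)
        (rev ys @ s # rev xs @ s # lifted_top al @ lowered_row (Suc s) al)"
      using free True lowered_row_free[OF free(2)]
      by (intro lift_state.pending) (auto simp: sorted_wrt_append)
    then show ?thesis using free True lowered_row_free[OF free(2)] by (intro exI conjI) auto
  next
    case False
    with assms(3) have st: "s < t" by simp
    have "lift_state ys xs ((s, Some t) # al)
        (rev ys @ rev xs @ lifted_top ((s, Some t) # al) @ lifted_row ((s, Some t) # al))"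
      using free st by (intro lift_state.free) (auto simp: sorted_wrt_append)
    moreover have "rev ys @ (t # rev xs @ s # lifted_top al) @ lifted_row al \<simeq>
        rev ys @ (rev xs @ t # lifted_top al @ [s]) @ lifted_row al"
      using free st by (intro ck_equiv_context ck_equiv_left_bump) (auto simp: sorted_wrt_append)
    ultimately show ?thesis using free by (intro exI conjI) auto
  qed
next
  case (pending a al')
  let ?L = "lowered_row (Suc a) al'"
  have a: "a = Suc s"
    using lift_state_pending_letter[of "t # ys" a "s # xs"] assms(2) pending by fastforce
  have t: "t = s" using pending(3) a assms(3) by (auto simp: sorted_wrt_append)
  have "lift_state ys xs ((s, Some s) # al)
      (rev ys @ s # rev xs @ s # lifted_top al @ lowered_row (Suc s) al)"
    using pending a t by (intro lift_state.pending) (auto simp: sorted_wrt_append)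
  moreover have "(rev ys @ [s]) @ (Suc s # rev xs @ s # Suc s # lifted_top al') @ ?L \<simeq>
      (rev ys @ [s]) @ (rev xs @ s # Suc s # lifted_top al' @ [s]) @ ?L"
    using pending(4) a by (intro ck_equiv_context ck_equiv_left_bump_Suc) simp
  ultimately show ?thesis using pending a t by (intro exI conjI) auto
qed

lemma lift_align_correct:
  assumes "align (\<le>) xs ys = (al, rest)" "lift_state ys xs acc w" "square_free_class w"
  shows "w \<simeq> rev rest @ lifted_top (rev al @ acc) @ lifted_row (rev al @ acc) \<and>
    sorted_wrt (<) (rev rest @ lifted_top (rev al @ acc)) \<and>
    sorted_wrt (<) (lifted_row (rev al @ acc))"
  using assms
proof (induction xs arbitrary: ys al acc w)
  case Nil
  from Nil.prems(2) show ?case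
  proof (cases rule: lift_state.cases)
    case free
    then show ?thesis using Nil.prems(1) by simp
  next
    \<comment> \<open>No lower letter is left to separate the two copies of \<open>a\<close>, so the
      alignment cannot end with a pending column.\<close>
    case (pending a al')
    then show ?thesis
      using Nil.prems(3) lift_state_pending_letter[of ys a "[]"] by fastforce
  qed
next
  case (Cons s xs)
  have sorted: "sorted_wrt (<) (rev ys)"
    using Cons.prems(2) by (cases rule: lift_state.cases) (auto simp: sorted_wrt_append)
  have step: ?case
    if "al = (s, o1) # al'" "align (\<le>) xs ys' = (al', rest)"
      "\<exists>w'. lift_state ys' xs ((s, o1) # acc) w' \<and> w \<simeq> w'" for o1 al' ys'
  proof -
    from that(3) obtain w' where w': "lift_state ys' xs ((s, o1) # acc) w'" "w \<simeq> w'" by blast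
    from Cons.IH[OF that(2) w'(1) square_free_class_ck[OF w'(2) Cons.prems(3)]] w'(2)
    show ?thesis by (auto simp: that(1) intro: equivclp_trans)
  qed
  \<comment> \<open>As \<open>ys\<close> is decreasing, its head alone decides the match, so
    \<open>s\<close> is unmatched exactly when all of \<open>ys\<close> lies below it.\<close>
  show ?case
  proof (cases "\<forall>y\<in>set ys. y < s")
    case True
    obtain al' rest' where al': "align (\<le>) xs ys = (al', rest')" by fastforce
    have "align (\<le>) (s # xs) ys = ((s, None) # al', rest')"
      using True al' align_Nil[of "(\<le>)" xs] by (cases ys) auto
    then show ?thesis
      using step[OF _ _ lift_state_unmatched[OF Cons.prems(2,3) True]] Cons.prems(1) al' by simp
  next
    case False
    then obtain t ys' where ys: "ys = t # ys'" by (cases ys) auto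
    have "s \<le> t" using False sorted unfolding ys by (auto simp: sorted_wrt_append)
    obtain al' rest' where al': "align (\<le>) xs ys' = (al', rest')" by fastforce
    then have "align (\<le>) (s # xs) ys = ((s, Some t) # al', rest')"
      using \<open>s \<le> t\<close> ys by simp
    then show ?thesis
      using step[OF _ _ lift_state_matched[OF Cons.prems(2)[unfolded ys] Cons.prems(3) \<open>s \<le> t\<close>]]
        Cons.prems(1) al' by simp
  qed
qed

lemma lift_pair_correct:
  assumes "sorted_wrt (<) \<tau>" "sorted_wrt (<) \<sigma>" "square_free_class (\<tau> @ \<sigma>)"
    "lift_pair \<tau> \<sigma> = (\<tau>', \<sigma>')"
  shows "\<tau> @ \<sigma> \<simeq> \<tau>' @ \<sigma>'" "sorted_wrt (<) \<tau>'" "sorted_wrt (<) \<sigma>'"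
proof -
  obtain al rest where al: "align (\<le>) (rev \<sigma>) (rev \<tau>) = (al, rest)" by fastforce
  have eq: "\<tau>' = rev rest @ lifted_top (rev al)" "\<sigma>' = lifted_row (rev al)"
    using lift_pair_eq[OF al] assms(4) by auto
  have "lift_state (rev \<tau>) (rev \<sigma>) []
      (rev (rev \<tau>) @ rev (rev \<sigma>) @ lifted_top [] @ lifted_row [])"
    using assms(1,2) by (intro lift_state.free) auto
  then have "lift_state (rev \<tau>) (rev \<sigma>) [] (\<tau> @ \<sigma>)" by simp
  from lift_align_correct[OF al this assms(3)]
  show "\<tau> @ \<sigma> \<simeq> \<tau>' @ \<sigma>'" "sorted_wrt (<) \<tau>'" "sorted_wrt (<) \<sigma>'" by (auto simp: eq)
qed

lemma length_matched_snd: "length (matched_snd al) \<le> length al"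
  by (induction al rule: matched_snd.induct) auto

lemma matched_snd_append [simp]: "matched_snd (al @ al') = matched_snd al @ matched_snd al'"
  by (induction al rule: matched_snd.induct) auto

lemma matched_snd_rev: "matched_snd (rev al) = rev (matched_snd al)"
  by (induction al rule: matched_snd.induct) auto

lemma length_lifted_top: "length (lifted_top al) = length al"
  by (induction al rule: lifted_top.induct) auto

lemma lifted_all_matched:
  "length (matched_snd al) = length al \<Longrightarrow> lifted_top al = matched_snd al \<and> lifted_row al = map fst al"
proof (induction al rule: matched_snd.induct)
  case (2 x al)
  then show ?case using length_matched_snd[of al] by simp
qed auto

text \<open>If every lower letter is matched, nothing moves and nothing is lowered. A change
  therefore means an unmatched letter, which moves up.\<close>

lemma lift_pair_length_less:
  assumes "lift_pair \<tau> \<sigma> = (\<tau>', \<sigma>')" "(\<tau>', \<sigma>') \<noteq> (\<tau>, \<sigma>)"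
  shows "length \<tau> < length \<tau>'"
proof -
  obtain al rest where al: "align (\<le>) (rev \<sigma>) (rev \<tau>) = (al, rest)" by fastforce
  have eq: "\<tau>' = rev rest @ lifted_top (rev al)" "\<sigma>' = lifted_row (rev al)"
    using lift_pair_eq[OF al] assms(1) by auto
  have "rev (matched_snd al @ rest) = \<tau>" using align_matched[OF al] by simp
  then have \<tau>: "\<tau> = rev rest @ matched_snd (rev al)" by (simp add: matched_snd_rev)
  have \<sigma>: "\<sigma> = map fst (rev al)"
    using align_fst[of "(\<le>)" "rev \<sigma>" "rev \<tau>"] al by (simp add: rev_map[symmetric])
  have "length (matched_snd (rev al)) \<noteq> length (rev al)"
    using lifted_all_matched[of "rev al"] assms(2) eq \<tau> \<sigma> by metis
  then show ?thesis
    using length_matched_snd[of "rev al"] length_lifted_top[of "rev al"] by (simp add: eq \<tau>)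
qed

lemma length_row_reading_word: "length (row_reading_word R) = length (concat R)"
  by (induction R) auto

lemma lift_at_correct:
  assumes k: "Suc k < length R" and R: "increasing_rows R" "square_free_class (row_reading_word R)"
  shows "increasing_rows (lift_at k R)" "row_reading_word R \<simeq> row_reading_word (lift_at k R)"
    and "lift_at k R \<noteq> R \<Longrightarrow> total_height R < total_height (lift_at k R)"
proof -
  obtain \<tau> \<sigma> where p: "lift_pair (R ! Suc k) (R ! k) = (\<tau>, \<sigma>)" by fastforce
  have rows: "sorted_wrt (<) (R ! k)" "sorted_wrt (<) (R ! Suc k)" using R(1) k by auto
  note correct = lift_pair_correct[OF rows(2,1) square_free_class_rows[OF k R(2)] p]
  have eq: "lift_at k R = R[k := \<sigma>, Suc k := \<tau>]" by (simp add: lift_at_def p)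
  show "increasing_rows (lift_at k R)"
    unfolding eq using increasing_rows_update R(1) correct(2,3) by blast
  show "row_reading_word R \<simeq> row_reading_word (lift_at k R)"
    unfolding eq using row_reading_word_update[OF k correct(1)] .
  assume "lift_at k R \<noteq> R"
  then have "(\<tau>, \<sigma>) \<noteq> (R ! Suc k, R ! k)" by (auto simp: eq)
  then have less: "length (R ! Suc k) < length \<tau>" using lift_pair_length_less[OF p] by blast
  let ?R = "lift_at k R"
  \<comment> \<open>The measure lemma describes a decrease, so it is applied backwards: restoring
    the two old rows undoes the lift.\<close>
  have restore: "?R[k := R ! k, Suc k := R ! Suc k] = R"
    using k by (intro nth_equalityI) (auto simp: eq nth_list_update)
  have "length (R ! k) + length (R ! Suc k) = length (?R ! k) + length (?R ! Suc k)"
    "length (R ! Suc k) < length (?R ! Suc k)" "Suc k < length ?R"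
    using k less ck_equiv_length[OF correct(1)] by (auto simp: eq)
  then show "total_height R < total_height ?R"
    using total_height_update_less[of k ?R "R ! k" "R ! Suc k"] unfolding restore by blast
qed

lemma lift_seq_correct:
  assumes "increasing_rows R" "square_free_class (row_reading_word R)" "i \<le> m" "m < length R"
    "\<forall>k\<in>{i..<m}. lift_at k (lift_seq i k R) \<noteq> lift_seq i k R"
  shows "length (lift_seq i m R) = length R \<and> increasing_rows (lift_seq i m R) \<and>
    row_reading_word R \<simeq> row_reading_word (lift_seq i m R) \<and>
    (i < m \<longrightarrow> total_height R < total_height (lift_seq i m R))"
  using assms(3-5)
proof (induction m rule: dec_induct)
  case base
  then show ?case using assms(1) by (simp add: lift_seq_def)
next
  case (step m)
  let ?S = "lift_seq i m R"
  have IH: "length ?S = length R" "increasing_rows ?S" "row_reading_word R \<simeq> row_reading_word ?S"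
    "i < m \<longrightarrow> total_height R < total_height ?S"
    using step by auto
  have Suc: "lift_seq i (Suc m) R = lift_at m ?S" using step(1) by (simp add: lift_seq_def)
  have m: "Suc m < length ?S" using step.prems(1) IH(1) by simp
  note lift = lift_at_correct[OF m IH(2) square_free_class_ck[OF IH(3) assms(2)]]
  have "total_height ?S < total_height (lift_at m ?S)"
    using lift(3) step.prems(2) step(1) by simp
  moreover have "total_height R \<le> total_height ?S"
    using IH(4) step(1) by (cases "i = m") (auto simp: lift_seq_def)
  moreover have "length (lift_at m ?S) = length R"
    using IH(1) by (simp add: lift_at_def split: prod.split)
  ultimately show ?case
    unfolding Suc using lift(1,2) IH(3) by (auto intro: equivclp_trans)
qed

lemma lift_step_correct:
  assumes R: "increasing_rows R" "square_free_class (row_reading_word R)"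
    and ex: "\<exists>i. Suc i < length R \<and> lift_at i R \<noteq> R"
  shows "length (lift_step R) = length R \<and> increasing_rows (lift_step R) \<and>
    row_reading_word R \<simeq> row_reading_word (lift_step R) \<and>
    total_height R < total_height (lift_step R)"
proof -
  define j where "j = (GREATEST j. \<exists>i. lift_faithful i j R)"
  define i where "i = (LEAST i. lift_faithful i j R)"
  obtain i0 where "Suc i0 < length R" "lift_at i0 R \<noteq> R" using ex by blast
  \<comment> \<open>A single effective lift is a faithful sequence of length one, so the greatest
    and least indices range over nonempty sets.\<close>
  then have "lift_faithful i0 i0 R" by (simp add: lift_faithful_def lift_seq_def)
  moreover have "\<And>j. \<exists>i. lift_faithful i j R \<Longrightarrow> j \<le> length R"
    by (auto simp: lift_faithful_def)
  ultimately have "\<exists>i. lift_faithful i j R"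
    unfolding j_def using GreatestI_ex_nat[of "\<lambda>j. \<exists>i. lift_faithful i j R" "length R"] by blast
  then have faithful: "lift_faithful i j R" unfolding i_def by (rule LeastI_ex)
  have "lift_step R = lift_seq i (Suc j) R"
    by (simp add: lift_step_def Let_def i_def j_def)
  then show ?thesis
    using lift_seq_correct[OF R, of i "Suc j"] faithful
    by (auto simp: lift_faithful_def)
qed

lemma lift_tableau_correct:
  assumes "increasing_rows P" "square_free_class (row_reading_word P)"
  shows "row_reading_word P \<simeq> row_reading_word (lift_tableau P)"
proof -
  let ?I = "\<lambda>R. increasing_rows R \<and> row_reading_word P \<simeq> row_reading_word R"
  \<comment> \<open>Lifts keep the numbers of rows and letters, so this product is a fixed upper
    bound for the growing \<open>total_height\<close>.\<close>
  let ?m = "\<lambda>R. length R * length (concat R) - total_height R"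
  have "?I (lift_tableau P)"
    unfolding lift_tableau_def
  proof (rule while_rule[where P = ?I and r = "measure ?m"])
    fix R assume R: "?I R" and ex: "\<exists>i. Suc i < length R \<and> lift_at i R \<noteq> R"
    from R have sf: "square_free_class (row_reading_word R)"
      using square_free_class_ck assms(2) by blast
    note step = lift_step_correct[OF conjunct1[OF R] sf ex]
    show "?I (lift_step R)" using step R by (auto intro: equivclp_trans)
    have "length (concat R) = length (concat (lift_step R))"
      using step ck_equiv_length length_row_reading_word by metis
    then show "(lift_step R, R) \<in> measure ?m"
      using step total_height_le[of "lift_step R"] by auto
  qed (use assms in auto)
  then show ?thesis by blast
qed

section \<open>Weak insertion\<close>

text \<open>The next round starts with a drop, which undoes the lift: the lifted word is still in
  the class of \<open>w\<close>, so its drop is the Edelman--Greene tableau of \<open>w\<close>, and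
  inserting \<open>x\<close> extends that tableau. Only the last lift survives.\<close>

lemma weak_insertion_tableau_eq:
  "square_free_class w \<Longrightarrow>
    weak_insertion_tableau w = row_reading_word (lift_tableau (eg_tableau w))"
proof (induction w rule: rev_induct)
  case Nil
  have "lift_tableau [] = []" unfolding lift_tableau_def by (subst while_unfold) simp
  then show ?case by (simp add: weak_insertion_tableau_def eg_tableau_def)
next
  case (snoc x w)
  have w: "square_free_class w" using snoc.prems by (rule square_free_class_prefix)
  let ?v = "weak_insertion_tableau w"
  note eg = eg_tableau_correct[OF w]
  have "w \<simeq> ?v"
    unfolding snoc.IH[OF w]
    using eg lift_tableau_correct[OF eg(1) square_free_class_ck[OF eg(2) w]]
    by (blast intro: equivclp_trans)
  then have "drop_word ?v = eg_tableau w"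
    using drop_word_eq eg_tableau_ck_equiv square_free_class_ck w by metis
  then show ?case by (simp add: weak_insertion_tableau_def eg_tableau_def)
qed

lemma weak_insertion_tableau_ck_equiv:
  assumes "square_free_class w"
  shows "w \<simeq> weak_insertion_tableau w"
  unfolding weak_insertion_tableau_eq[OF assms]
  using eg_tableau_correct[OF assms] lift_tableau_correct square_free_class_ck assms
  by (meson equivclp_trans)

theorem theorem5p7:
  fixes \<sigma> \<tau> :: "nat list"
  assumes "reduced \<sigma>" and "reduced \<tau>"
  shows "weak_insertion_tableau \<sigma> = weak_insertion_tableau \<tau> \<longleftrightarrow> coxeter_knuth_equiv \<sigma> \<tau>"
proof -
  have sf: "square_free_class \<sigma>" "square_free_class \<tau>"
    using assms reduced_square_free_class by blast+
  show ?thesis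
    unfolding coxeter_knuth_equiv_iff
  proof
    assume "weak_insertion_tableau \<sigma> = weak_insertion_tableau \<tau>"
    then show "\<sigma> \<simeq> \<tau>"
      using weak_insertion_tableau_ck_equiv sf by (metis equivclp_sym equivclp_trans)
  next
    assume "\<sigma> \<simeq> \<tau>"
    then show "weak_insertion_tableau \<sigma> = weak_insertion_tableau \<tau>"
      using eg_tableau_ck_equiv sf by (simp add: weak_insertion_tableau_eq)
  qed
qed

end
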